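(* Let $(\gamma_1,\eta_1):I_1\rightarrow X\times S$ and $(\gamma_2,\eta_2):I_2\rightarrow X\times S$ be Legendre curves with curvature pairs $(\alpha_1,\kappa_1)$ and $(\alpha_2,\kappa_2)$, respectively. If these curves have at least $k$-th order contact at $t=t_0$ and $u=u_0$, then $$\frac{d^j}{dt^j}(\alpha_1,\kappa_1)(t_0)=\frac{d^j}{du^j}(\alpha_2,\kappa_2)(u_0)\quad\text{for } j=0,\dots,k-1.$$ However, the converse may not be true (even up to isometry) if the norm is not Euclidean.
   Context: Let $(X,\|\cdot\|)$ be a two-dimensional real normed space with unit circle $S=\{x\in X:\|x\|=1\}$. The plane is assumed smooth ($S$ is a smooth curve) and strictly convex ($S$ contains no line segment). Fix a nondegenerate symplectic (alternating) bilinear form $[\cdot,\cdot]$ on $X$. For $x,y\in X$, $x\dashv_B y$ (Birkhoff orthogonality) means $\|x+ty\|\ge\|x\|$ for all $t\in\mathbb{R}$. For $v\in X\setminus\{o\}$ let $b(v)\in S$ be the unique vector with $v\dashv_B b(v)$ and $[v,b(v)]>0$. A Legendre curve is a smooth map $(\gamma,\eta):I\rightarrow X\times S$ ($I$ an interval) with $\eta(t)\dashv_B\gamma'(t)$ for all $t\in I$. Its curvature pair is the pair of smooth functions $(\alpha,\kappa)$ with $\gamma'(t)=\alpha(t)b(\eta(t))$ and $\eta'(t)=\kappa(t)b(\eta(t))$. Given $k\in\mathbb{N}$, two Legendre curves $(\gamma_1,\eta_1)$ (parameter $t$) and $(\gamma_2,\eta_2)$ (parameter $u$) have $k$-th order contact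 at $t=t_0$, $u=u_0$ if $\frac{d^j}{dt^j}(\gamma_1,\eta_1)(t_0)=\frac{d^j}{du^j}(\gamma_2,\eta_2)(u_0)$ for $j=0,\dots,k-1$ and $\frac{d^k}{dt^k}(\gamma_1,\eta_1)(t_0)\neq\frac{d^k}{du^k}(\gamma_2,\eta_2)(u_0)$; if only the first condition (equality for $j=0,\dots,k-1$) holds, they are said to have at least $k$-th order contact at $t=t_0$ and $u=u_0$. An isometry of the plane is a norm-preserving map $T:X\to X$; it is linear up to translation.
   Formalization: The first part assumes at least (k+1)-th order contact instead of k-th: as printed it fails, e.g. for k=1 with constant η, γ₁=p+t·b(η), γ₂=p+2u·b(η) at t₀=u₀=0, where the values agree but α₁=1 and α₂=2. *)

theory Defs
  imports "HOL-Analysis.Analysis"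
begin

text \<open>Derivatives are taken within the parameter interval, hence one-sided at an endpoint that
  belongs to it.\<close>

primrec nth_derivative ::
    "real set \<Rightarrow> nat \<Rightarrow> (real \<Rightarrow> 'b::real_normed_vector) \<Rightarrow> real \<Rightarrow> 'b" where
  "nth_derivative I 0 f = f"
| "nth_derivative I (Suc n) f = (\<lambda>t. vector_derivative (nth_derivative I n f) (at t within I))"

definition smooth_map_on :: "real set \<Rightarrow> (real \<Rightarrow> 'b::real_normed_vector) \<Rightarrow> bool" where
  "smooth_map_on I f \<longleftrightarrow> (\<forall>n. \<forall>t\<in>I. nth_derivative I n f differentiable (at t within I))"

definition nondegenerate_interval :: "real set \<Rightarrow> bool" where
  "nondegenerate_interval I \<longleftrightarrow> is_interval I \<and> interior I \<noteq> {}"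

text \<open>The next three predicates concern the norm of the type \<open>'a\<close>.\<close>

definition smooth_unit_circle :: "'a::real_normed_vector itself \<Rightarrow> bool" where
  "smooth_unit_circle _ \<longleftrightarrow>
     (\<exists>\<phi> :: real \<Rightarrow> 'a. smooth_map_on UNIV \<phi> \<and> (\<forall>s. vector_derivative \<phi> (at s) \<noteq> 0)
        \<and> range \<phi> = sphere 0 1)"

definition strictly_convex_norm :: "'a::real_normed_vector itself \<Rightarrow> bool" where
  "strictly_convex_norm _ \<longleftrightarrow>
     (\<forall>x y :: 'a. x \<noteq> y \<longrightarrow> \<not> closed_segment x y \<subseteq> sphere 0 1)"

definition euclidean_norm :: "'a::real_normed_vector itself \<Rightarrow> bool" where
  "euclidean_norm _ \<longleftrightarrow>
     (\<exists>g :: 'a \<Rightarrow> 'a \<Rightarrow> real. bilinear g \<and> (\<forall>x y. g x y = g y x) \<and> (\<forall>x. x \<noteq> 0 \<longrightarrow> g x x > 0)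
        \<and> (\<forall>x. norm x = sqrt (g x x)))"

definition symplectic_form :: "('a::real_vector \<Rightarrow> 'a \<Rightarrow> real) \<Rightarrow> bool" where
  "symplectic_form \<omega> \<longleftrightarrow>
     bilinear \<omega> \<and> (\<forall>x. \<omega> x x = 0) \<and> (\<forall>x. (\<forall>y. \<omega> x y = 0) \<longrightarrow> x = 0)"

definition birkhoff_orthogonal :: "'a::real_normed_vector \<Rightarrow> 'a \<Rightarrow> bool" (infix "\<stileturn>\<^sub>B" 50) where
  "x \<stileturn>\<^sub>B y \<longleftrightarrow> (\<forall>t::real. norm (x + t *\<^sub>R y) \<ge> norm x)"

text \<open>Meaningful for \<open>v \<noteq> 0\<close>; existence and uniqueness hold in a smooth plane.\<close>

definition birkhoff_dir :: "('a::real_normed_vector \<Rightarrow> 'a \<Rightarrow> real) \<Rightarrow> 'a \<Rightarrow> 'a" where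
  "birkhoff_dir \<omega> v = (THE w. w \<in> sphere 0 1 \<and> v \<stileturn>\<^sub>B w \<and> \<omega> v w > 0)"

definition legendre_curve ::
    "real set \<Rightarrow> (real \<Rightarrow> 'a::real_normed_vector) \<Rightarrow> (real \<Rightarrow> 'a) \<Rightarrow> bool" where
  "legendre_curve I \<gamma> \<eta> \<longleftrightarrow>
     nondegenerate_interval I \<and> smooth_map_on I (\<lambda>t. (\<gamma> t, \<eta> t)) \<and>
     (\<forall>t\<in>I. \<eta> t \<in> sphere 0 1 \<and> \<eta> t \<stileturn>\<^sub>B vector_derivative \<gamma> (at t within I))"

definition curvature_pair ::
    "('a::real_normed_vector \<Rightarrow> 'a \<Rightarrow> real) \<Rightarrow> real set \<Rightarrow> (real \<Rightarrow> 'a) \<Rightarrow> (real \<Rightarrow> 'a)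
       \<Rightarrow> (real \<Rightarrow> real) \<Rightarrow> (real \<Rightarrow> real) \<Rightarrow> bool" where
  "curvature_pair \<omega> I \<gamma> \<eta> \<alpha> \<kappa> \<longleftrightarrow>
     smooth_map_on I \<alpha> \<and> smooth_map_on I \<kappa> \<and>
     (\<forall>t\<in>I. vector_derivative \<gamma> (at t within I) = \<alpha> t *\<^sub>R birkhoff_dir \<omega> (\<eta> t) \<and>
             vector_derivative \<eta> (at t within I) = \<kappa> t *\<^sub>R birkhoff_dir \<omega> (\<eta> t))"

text \<open>At least \<open>k\<close>-th order contact prescribes the derivatives of order strictly below \<open>k\<close> only.
  As \<open>(\<alpha>, \<kappa>)\<close> is read off from the first derivative of \<open>(\<gamma>, \<eta>)\<close>, it takes at least
  \<open>(k + 1)\<close>-th order contact to determine the derivatives of \<open>(\<alpha>, \<kappa>)\<close> of order below \<open>k\<close>.\<close>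

definition at_least_contact ::
    "nat \<Rightarrow> real set \<Rightarrow> (real \<Rightarrow> 'a::real_normed_vector) \<Rightarrow> (real \<Rightarrow> 'a) \<Rightarrow> real
         \<Rightarrow> real set \<Rightarrow> (real \<Rightarrow> 'a) \<Rightarrow> (real \<Rightarrow> 'a) \<Rightarrow> real \<Rightarrow> bool" where
  "at_least_contact k I\<^sub>1 \<gamma>\<^sub>1 \<eta>\<^sub>1 t\<^sub>0 I\<^sub>2 \<gamma>\<^sub>2 \<eta>\<^sub>2 u\<^sub>0 \<longleftrightarrow>
     (\<forall>j<k. nth_derivative I\<^sub>1 j (\<lambda>t. (\<gamma>\<^sub>1 t, \<eta>\<^sub>1 t)) t\<^sub>0
           = nth_derivative I\<^sub>2 j (\<lambda>u. (\<gamma>\<^sub>2 u, \<eta>\<^sub>2 u)) u\<^sub>0)"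

definition plane_isometry :: "('a::real_normed_vector \<Rightarrow> 'a) \<Rightarrow> bool" where
  "plane_isometry T \<longleftrightarrow> (\<forall>x y. norm (T x - T y) = norm (x - y))"

text \<open>An isometry acts on the direction field \<open>\<eta>\<close> of a Legendre curve by its linear part.\<close>

definition linear_part :: "('a::real_normed_vector \<Rightarrow> 'a) \<Rightarrow> 'a \<Rightarrow> 'a" where
  "linear_part T x = T x - T 0"

end

theory Submission
  imports Defs
begin

text \<open>
The first part says that the curvature pair is a smooth function of the first derivative of the
curve. As \<open>\<gamma>' = \<alpha> b(\<eta>)\<close> and \<open>\<eta>' = \<kappa> b(\<eta>)\<close>, the functions \<open>\<alpha>\<close> and \<open>\<kappa>\<close> are quotients whose numerators are
\<open>\<omega> \<eta> \<gamma>'\<close> and \<open>\<omega> \<eta> \<eta>'\<close> and whose denominator is \<open>\<omega> \<eta> b(\<eta>)\<close>; what matters is that the jet of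
\<open>b \<circ> \<eta>\<close> depends only on the jet of \<open>\<eta>\<close>. If \<open>\<phi>\<close> is a smooth regular parametrisation of the unit circle,
then \<open>b(\<phi> s)\<close> is the normalised tangent vector at \<open>\<phi> s\<close>, up to a sign that does not depend on \<open>s\<close>.
It remains to see that a local angle \<open>s\<close> with \<open>\<eta> = \<phi> \<circ> s\<close> and the norm of the tangent vector
inherit contact. Both questions concern the polar coordinates \<open>c = r *\<^sub>R (\<phi> \<circ> s)\<close> of a plane curve \<open>c\<close>,
and differentiating this relation gives
\<open>r' = \<omega> c' (\<phi>' s) / \<omega> (\<phi> s) (\<phi>' s)\<close> and \<open>s' = \<omega> (\<phi> s) c' / (r * \<omega> (\<phi> s) (\<phi>' s))\<close>.
The right-hand sides involve \<open>r\<close> and \<open>s\<close> only to order 0, so induction on the order of contact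
transfers contact from \<open>c\<close> to \<open>r\<close> and \<open>s\<close> (\<open>polar_coordinates\<close>, \<open>common_jet_polar\<close>,
\<open>common_jet_birkhoff_dir\<close>).

For the second part, constant curves suffice. A constant curve whose direction is a fixed unit
vector has curvature pair 0, so two of them have the same curvature data, while an isometry that
creates contact must carry one unit vector to the other. In a strictly convex plane isometries
are affine. Hence it is enough that the linear isometries of a non-Euclidean plane do not act
transitively on the unit circle. Indeed, among the positive semidefinite quadratic forms below the
squared norm there is exactly one of maximal discriminant (this is the Loewner ellipse of the unit
ball); by uniqueness it is invariant under all linear isometries, and if these act transitively,
then the form is constant on the unit circle and the norm is Euclidean
(\<open>maximal_form_invariant\<close>, \<open>euclidean_if_transitive\<close>).
\<close>

section \<open>Properties that hold near a point of a parameter set\<close>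

abbreviation near_within :: "real \<Rightarrow> real set \<Rightarrow> real filter" where
  "near_within t I \<equiv> inf (nhds t) (principal I)"

lemma eventually_near_within:
  "eventually P (near_within t I) \<longleftrightarrow> (\<exists>U. open U \<and> t \<in> U \<and> (\<forall>s\<in>U \<inter> I. P s))"
  unfolding eventually_inf_principal eventually_nhds by blast

lemma eventually_near_within_near_within:
  assumes "eventually P (near_within t I)"
  shows "\<forall>\<^sub>F s in near_within t I. eventually P (near_within s I)"
  using assms unfolding eventually_near_within by blast

lemma eventually_near_within_self:
  assumes "eventually P (near_within t I)" "t \<in> I"
  shows "P t"
  using assms unfolding eventually_near_within by blast

lemma eventually_near_within_continuous:
  assumes "(f has_vector_derivative f') (at t within I)" "open S" "f t \<in> S"
  shows "\<forall>\<^sub>F s in near_within t I. f s \<in> S"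
proof -
  have "(f \<longlongrightarrow> f t) (at t within I)"
    using has_vector_derivative_continuous[OF assms(1)] by (simp add: continuous_within)
  then have "\<forall>\<^sub>F s in at t within I. f s \<in> S"
    using assms(2,3) by (rule topological_tendstoD)
  then show ?thesis
    using assms(3) unfolding eventually_at_filter eventually_inf_principal
    by (auto elim!: eventually_mono)
qed

lemma has_vector_derivative_cong_near_within:
  assumes "(f has_vector_derivative d) (at t within I)"
    and "\<forall>\<^sub>F s in near_within t I. f s = g s" and "t \<in> I"
  shows "(g has_vector_derivative d) (at t within I)"
proof -
  obtain U where U: "open U" "t \<in> U" "\<And>s. s \<in> U \<inter> I \<Longrightarrow> f s = g s"
    using assms(2) unfolding eventually_near_within by blast
  have "(f has_derivative (\<lambda>x. x *\<^sub>R d)) (at t within I)"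
    using assms(1) by (simp add: has_vector_derivative_def)
  moreover have "\<forall>\<^sub>F s in at t within I. f s = g s"
    using U unfolding eventually_at_topological by blast
  ultimately show ?thesis
    unfolding has_vector_derivative_def
    by (rule has_derivative_transform_eventually)
      (use U assms(3) in auto)
qed

section \<open>Families of curves with a common jet\<close>

lemma nth_derivative_Suc_shift:
  "nth_derivative J (Suc n) f = nth_derivative J n (nth_derivative J 1 f)"
  by (induction n) auto

lemma smooth_map_on_derivative:
  "smooth_map_on J f \<Longrightarrow> smooth_map_on J (nth_derivative J 1 f)"
  unfolding smooth_map_on_def nth_derivative_Suc_shift[symmetric] by blast

lemma smooth_map_on_has_vector_derivative:
  assumes "smooth_map_on J f" "t \<in> J"
  shows "(f has_vector_derivative nth_derivative J 1 f t) (at t within J)"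
  using assms(1)[unfolded smooth_map_on_def, rule_format, of t 0] assms(2)
  by (simp add: vector_derivative_works[symmetric])

text \<open>Agreement of all derivatives of order below \<open>m\<close> at the base points \<open>\<tau> i\<close>. The derivatives are
existentially quantified and only required near the base point: each closure property below is
then proved by exhibiting a derivative, without any formula for higher derivatives, and it applies
to functions, such as a local angle, that are meaningful near the base point only. A family indexed by
\<open>'i\<close> replaces the two curves of a contact, so that every rule of differentiation is used once
instead of twice. At order \<open>Suc 0\<close> the curves must be differentiable near the base point although no
derivative is compared.\<close>

primrec common_jet ::
    "nat \<Rightarrow> ('i \<Rightarrow> real set) \<Rightarrow> ('i \<Rightarrow> real) \<Rightarrow> ('i \<Rightarrow> real \<Rightarrow> 'b::real_normed_vector) \<Rightarrow> bool" where
  "common_jet 0 I \<tau> f \<longleftrightarrow> True"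
| "common_jet (Suc m) I \<tau> f \<longleftrightarrow> (\<exists>c. \<forall>i. f i (\<tau> i) = c) \<and>
     (\<exists>f'. (\<forall>i. \<forall>\<^sub>F t in near_within (\<tau> i) (I i). (f i has_vector_derivative f' i t) (at t within I i))
         \<and> common_jet m I \<tau> f')"

locale curve_family =
  fixes I :: "'i \<Rightarrow> real set" and \<tau> :: "'i \<Rightarrow> real"
  assumes base_point: "\<tau> i \<in> I i"
begin

abbreviation near :: "'i \<Rightarrow> real filter" where
  "near i \<equiv> near_within (\<tau> i) (I i)"

lemma eventually_near_I: "\<forall>\<^sub>F t in near i. t \<in> I i"
  by (simp add: eventually_inf_principal)

lemma common_jet_SucI:
  assumes "\<And>i. f i (\<tau> i) = c"
    and "\<And>i. \<forall>\<^sub>F t in near i. (f i has_vector_derivative f' i t) (at t within I i)"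
    and "common_jet m I \<tau> f'"
  shows "common_jet (Suc m) I \<tau> f"
  using assms by auto

lemma common_jet_SucE:
  assumes "common_jet (Suc m) I \<tau> f"
  obtains c f' where "\<And>i. f i (\<tau> i) = c"
    and "\<And>i. \<forall>\<^sub>F t in near i. (f i has_vector_derivative f' i t) (at t within I i)"
    and "common_jet m I \<tau> f'"
  using assms by auto

lemma common_jet_cong:
  assumes "common_jet m I \<tau> f" and "\<And>i. \<forall>\<^sub>F t in near i. f i t = g i t"
  shows "common_jet m I \<tau> g"
proof (cases m)
  case (Suc n)
  obtain c f' where c: "\<And>i. f i (\<tau> i) = c"
    and f': "\<And>i. \<forall>\<^sub>F t in near i. (f i has_vector_derivative f' i t) (at t within I i)"
    and jet: "common_jet n I \<tau> f'"
    using assms(1) unfolding Suc by (rule common_jet_SucE) blast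
  show ?thesis
    unfolding Suc
  proof (rule common_jet_SucI[OF _ _ jet])
    show "g i (\<tau> i) = c" for i
      using c eventually_near_within_self[OF assms(2) base_point] by metis
    show "\<forall>\<^sub>F t in near i. (g i has_vector_derivative f' i t) (at t within I i)" for i
      using f'[of i] eventually_near_within_near_within[OF assms(2)[of i]] eventually_near_I
      by eventually_elim (rule has_vector_derivative_cong_near_within)
  qed
qed simp

lemma common_jet_Suc_imp:
  "common_jet (Suc m) I \<tau> f \<Longrightarrow> common_jet m I \<tau> f"
proof (induction m arbitrary: f)
  case (Suc m)
  from Suc.prems obtain c f' where "\<And>i. f i (\<tau> i) = c"
    "\<And>i. \<forall>\<^sub>F t in near i. (f i has_vector_derivative f' i t) (at t within I i)"
    "common_jet (Suc m) I \<tau> f'"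
    by (rule common_jet_SucE) blast
  then show ?case
    using Suc.IH by (blast intro: common_jet_SucI)
qed simp

lemma common_jet_const: "common_jet m I \<tau> (\<lambda>i t. c)"
proof (induction m arbitrary: c)
  case (Suc m)
  show ?case
    by (rule common_jet_SucI[OF _ _ Suc[of 0]]) auto
qed simp

lemma common_jet_add:
  "common_jet m I \<tau> f \<Longrightarrow> common_jet m I \<tau> g \<Longrightarrow> common_jet m I \<tau> (\<lambda>i t. f i t + g i t)"
proof (induction m arbitrary: f g)
  case (Suc m)
  from Suc.prems(1) obtain c f' where f: "\<And>i. f i (\<tau> i) = c"
    "\<And>i. \<forall>\<^sub>F t in near i. (f i has_vector_derivative f' i t) (at t within I i)"
    "common_jet m I \<tau> f'"
    by (rule common_jet_SucE) blast
  from Suc.prems(2) obtain d g' where g: "\<And>i. g i (\<tau> i) = d"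
    "\<And>i. \<forall>\<^sub>F t in near i. (g i has_vector_derivative g' i t) (at t within I i)"
    "common_jet m I \<tau> g'"
    by (rule common_jet_SucE) blast
  show ?case
  proof (rule common_jet_SucI[OF _ _ Suc.IH[OF f(3) g(3)]])
    show "\<forall>\<^sub>F t in near i. ((\<lambda>t. f i t + g i t) has_vector_derivative f' i t + g' i t) (at t within I i)" for i
      using f(2)[of i] g(2)[of i] by eventually_elim (rule has_vector_derivative_add)
  qed (simp add: f(1) g(1))
qed simp

lemma common_jet_bounded_linear:
  assumes "bounded_linear h"
  shows "common_jet m I \<tau> f \<Longrightarrow> common_jet m I \<tau> (\<lambda>i t. h (f i t))"
proof (induction m arbitrary: f)
  case (Suc m)
  from Suc.prems obtain c f' where f: "\<And>i. f i (\<tau> i) = c"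
    "\<And>i. \<forall>\<^sub>F t in near i. (f i has_vector_derivative f' i t) (at t within I i)"
    "common_jet m I \<tau> f'"
    by (rule common_jet_SucE) blast
  show ?case
  proof (rule common_jet_SucI[OF _ _ Suc.IH[OF f(3)]])
    show "\<forall>\<^sub>F t in near i. ((\<lambda>t. h (f i t)) has_vector_derivative h (f' i t)) (at t within I i)" for i
      using f(2)[of i]
      by eventually_elim (rule bounded_linear.has_vector_derivative[OF assms])
  qed (simp add: f(1))
qed simp

lemma common_jet_Pair:
  assumes "common_jet m I \<tau> f" "common_jet m I \<tau> g"
  shows "common_jet m I \<tau> (\<lambda>i t. (f i t, g i t))"
proof -
  have "common_jet m I \<tau> (\<lambda>i t. (f i t, 0) + (0, g i t))"
    by (intro common_jet_add common_jet_bounded_linear[OF _ assms(1)] common_jet_bounded_linear[OF _ assms(2)]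
        bounded_linear_Pair bounded_linear_ident bounded_linear_zero)
  then show ?thesis
    by simp
qed

lemma common_jet_bilinear:
  assumes "bounded_bilinear h"
  shows "common_jet m I \<tau> f \<Longrightarrow> common_jet m I \<tau> g \<Longrightarrow> common_jet m I \<tau> (\<lambda>i t. h (f i t) (g i t))"
proof (induction m arbitrary: f g)
  case (Suc m)
  from Suc.prems(1) obtain c f' where f: "\<And>i. f i (\<tau> i) = c"
    "\<And>i. \<forall>\<^sub>F t in near i. (f i has_vector_derivative f' i t) (at t within I i)"
    "common_jet m I \<tau> f'"
    by (rule common_jet_SucE) blast
  from Suc.prems(2) obtain d g' where g: "\<And>i. g i (\<tau> i) = d"
    "\<And>i. \<forall>\<^sub>F t in near i. (g i has_vector_derivative g' i t) (at t within I i)"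
    "common_jet m I \<tau> g'"
    by (rule common_jet_SucE) blast
  have jet: "common_jet m I \<tau> (\<lambda>i t. h (f i t) (g' i t) + h (f' i t) (g i t))"
    using Suc.prems[THEN common_jet_Suc_imp] f(3) g(3) by (intro common_jet_add Suc.IH)
  show ?case
  proof (rule common_jet_SucI[OF _ _ jet])
    show "\<forall>\<^sub>F t in near i. ((\<lambda>t. h (f i t) (g i t)) has_vector_derivative
        h (f i t) (g' i t) + h (f' i t) (g i t)) (at t within I i)" for i
      using f(2)[of i] g(2)[of i]
      by eventually_elim (rule bounded_bilinear.has_vector_derivative[OF assms])
  qed (simp add: f(1) g(1))
qed simp

lemmas common_jet_mult = common_jet_bilinear[OF bounded_bilinear_mult]
lemmas common_jet_scaleR = common_jet_bilinear[OF bounded_bilinear_scaleR]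

lemma common_jet_inverse:
  fixes f :: "'i \<Rightarrow> real \<Rightarrow> real"
  assumes "\<And>i. f i (\<tau> i) \<noteq> 0"
  shows "common_jet m I \<tau> f \<Longrightarrow> common_jet m I \<tau> (\<lambda>i t. inverse (f i t))"
proof (induction m)
  case (Suc m)
  from Suc.prems obtain c f' where f: "\<And>i. f i (\<tau> i) = c"
    "\<And>i. \<forall>\<^sub>F t in near i. (f i has_vector_derivative f' i t) (at t within I i)"
    "common_jet m I \<tau> f'"
    by (rule common_jet_SucE) blast
  have "common_jet m I \<tau> (\<lambda>i t. inverse (f i t))"
    using Suc by (blast intro: common_jet_Suc_imp)
  then have jet: "common_jet m I \<tau> (\<lambda>i t. - 1 * (inverse (f i t) * (f' i t * inverse (f i t))))"
    by (intro common_jet_mult common_jet_const f(3))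
  show ?case
  proof (rule common_jet_SucI[OF _ _ jet])
    fix i
    have "\<forall>\<^sub>F t in near i. f i t \<in> - {0}"
      using eventually_near_within_self[OF f(2) base_point] assms[of i]
      by (intro eventually_near_within_continuous) auto
    then show "\<forall>\<^sub>F t in near i. ((\<lambda>t. inverse (f i t)) has_vector_derivative
        - 1 * (inverse (f i t) * (f' i t * inverse (f i t)))) (at t within I i)"
      using f(2)[of i]
      by eventually_elim
        (simp add: has_real_derivative_iff_has_vector_derivative[symmetric] mult.assoc[symmetric]
          DERIV_inverse')
  qed (simp add: f(1))
qed simp

text \<open>The chain rule \<open>(g \<circ> f)' = f' *\<^sub>R (g' \<circ> f)\<close> lowers the order by one and replaces \<open>g\<close> by \<open>g'\<close>; the
induction must therefore run over all smooth \<open>g\<close> at once, and it makes Faa di Bruno's formula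
superfluous.\<close>

lemma common_jet_compose_smooth:
  fixes g :: "real \<Rightarrow> 'b::real_normed_vector"
  shows "smooth_map_on UNIV g \<Longrightarrow> common_jet m I \<tau> f \<Longrightarrow> common_jet m I \<tau> (\<lambda>i t. g (f i t))"
proof (induction m arbitrary: g)
  case (Suc m)
  from Suc.prems(2) obtain c f' where f: "\<And>i. f i (\<tau> i) = c"
    "\<And>i. \<forall>\<^sub>F t in near i. (f i has_vector_derivative f' i t) (at t within I i)"
    "common_jet m I \<tau> f'"
    by (rule common_jet_SucE) blast
  define g' where "g' = nth_derivative UNIV 1 g"
  have smooth: "smooth_map_on UNIV g'"
    unfolding g'_def using Suc.prems(1) by (rule smooth_map_on_derivative)
  have g: "(g has_vector_derivative g' s) (at s)" for s
    unfolding g'_def using smooth_map_on_has_vector_derivative[OF Suc.prems(1), of s] by simp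
  have "common_jet m I \<tau> (\<lambda>i t. g' (f i t))"
    using Suc.IH[OF smooth] Suc.prems(2) by (blast intro: common_jet_Suc_imp)
  then have jet: "common_jet m I \<tau> (\<lambda>i t. f' i t *\<^sub>R g' (f i t))"
    by (intro common_jet_scaleR f(3))
  show ?case
  proof (rule common_jet_SucI[OF _ _ jet])
    show "\<forall>\<^sub>F t in near i. ((\<lambda>t. g (f i t)) has_vector_derivative f' i t *\<^sub>R g' (f i t)) (at t within I i)" for i
      using f(2)[of i]
    proof eventually_elim
      case (elim t)
      show ?case
        using vector_diff_chain_within[OF elim has_vector_derivative_at_within[OF g]]
        by (simp add: o_def)
    qed
  qed (simp add: f(1))
qed simp

end

text \<open>A derivative within an interval is unique because no point of a nondegenerate interval is
isolated, not even an endpoint.\<close>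

lemma nondegenerate_interval_not_bot:
  assumes "nondegenerate_interval I" "t \<in> I"
  shows "at t within I \<noteq> bot"
proof -
  have "convex I"
    using assms by (simp add: nondegenerate_interval_def is_interval_convex)
  then have "I \<subseteq> closure (interior I)"
    using assms(1) by (metis closure_subset convex_closure_interior nondegenerate_interval_def)
  then have cl: "t \<in> closure (interior I)"
    using assms(2) by blast
  have "t islimpt interior I"
  proof (cases "t \<in> interior I")
    case True
    then show ?thesis
      by (simp add: interior_limit_point interior_interior open_interior)
  next
    case False
    then show ?thesis
      using cl by (simp add: closure_def)
  qed
  then have "t islimpt I"
    using interior_subset by (rule islimpt_subset)
  then show ?thesis
    using trivial_limit_within by blast
qed

lemma nth_derivative_cong_near_within:
  assumes "\<forall>\<^sub>F s in near_within t I. f s = g s" and "t \<in> I"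
  shows "nth_derivative I n f t = nth_derivative I n g t"
proof -
  have "\<forall>\<^sub>F s in near_within t I. nth_derivative I n f s = nth_derivative I n g s"
  proof (induction n)
    case (Suc n)
    have "\<forall>\<^sub>F s in near_within t I. s \<in> I"
      by (simp add: eventually_inf_principal)
    with eventually_near_within_near_within[OF Suc] show ?case
    proof eventually_elim
      case (elim s)
      have sym: "\<forall>\<^sub>F r in near_within s I. nth_derivative I n g r = nth_derivative I n f r"
        using elim(1) by eventually_elim simp
      have "(nth_derivative I n f has_vector_derivative d) (at s within I) \<longleftrightarrow>
            (nth_derivative I n g has_vector_derivative d) (at s within I)" for d
        using elim(2) has_vector_derivative_cong_near_within[OF _ elim(1)]
          has_vector_derivative_cong_near_within[OF _ sym] by blast
      then show ?case
        by (simp add: vector_derivative_def)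
    qed
  qed (simp add: assms)
  then show ?thesis
    using assms(2) by (rule eventually_near_within_self)
qed

locale interval_family = curve_family I \<tau>
  for I :: "'i \<Rightarrow> real set" and \<tau> +
  assumes interval: "nondegenerate_interval (I i)"
begin

lemma at_within_not_bot: "t \<in> I i \<Longrightarrow> at t within I i \<noteq> bot"
  using interval[of i] by (rule nondegenerate_interval_not_bot)

lemma common_jet_derivative:
  assumes "common_jet (Suc m) I \<tau> f"
    and "\<And>i. \<forall>\<^sub>F t in near i. (f i has_vector_derivative g i t) (at t within I i)"
  shows "common_jet m I \<tau> g"
proof -
  obtain c f' where f: "\<And>i. f i (\<tau> i) = c"
    "\<And>i. \<forall>\<^sub>F t in near i. (f i has_vector_derivative f' i t) (at t within I i)"
    "common_jet m I \<tau> f'"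
    using assms(1) by (rule common_jet_SucE) blast
  show ?thesis
  proof (rule common_jet_cong[OF f(3)])
    show "\<forall>\<^sub>F t in near i. f' i t = g i t" for i
      using f(2)[of i] assms(2)[of i] eventually_near_I
      by eventually_elim
        (rule vector_derivative_unique_within[OF at_within_not_bot])
  qed
qed

lemma common_jet_imp_nth_derivative_eq:
  "common_jet m I \<tau> f \<Longrightarrow> n < m \<Longrightarrow> nth_derivative (I i) n (f i) (\<tau> i) = nth_derivative (I j) n (f j) (\<tau> j)"
proof (induction n arbitrary: m f)
  case 0
  then obtain m' where "m = Suc m'"
    by (cases m) auto
  with 0 show ?case
    by auto
next
  case (Suc n)
  then obtain m' where m: "m = Suc m'" "n < m'"
    by (cases m) auto
  obtain c f' where f: "\<And>i. f i (\<tau> i) = c"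
    "\<And>i. \<forall>\<^sub>F t in near i. (f i has_vector_derivative f' i t) (at t within I i)"
    "common_jet m' I \<tau> f'"
    using Suc.prems(1) unfolding m by (rule common_jet_SucE) blast
  have "nth_derivative (I i) (Suc n) (f i) (\<tau> i) = nth_derivative (I i) n (f' i) (\<tau> i)" for i
    unfolding nth_derivative_Suc_shift
  proof (rule nth_derivative_cong_near_within[OF _ base_point])
    show "\<forall>\<^sub>F t in near i. nth_derivative (I i) 1 (f i) t = f' i t"
      using f(2)[of i] eventually_near_I
      by eventually_elim
        (simp add: vector_derivative_within at_within_not_bot)
  qed
  then show ?case
    using Suc.IH[OF f(3) m(2)] by simp
qed

lemma common_jetI:
  assumes "\<And>i. smooth_map_on (I i) (f i)"
    and "\<And>n i j. n < m \<Longrightarrow> nth_derivative (I i) n (f i) (\<tau> i) = nth_derivative (I j) n (f j) (\<tau> j)"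
  shows "common_jet m I \<tau> f"
  using assms
proof (induction m arbitrary: f)
  case (Suc m)
  define f' where "f' i = nth_derivative (I i) 1 (f i)" for i
  have jet: "common_jet m I \<tau> f'"
  proof (rule Suc.IH)
    show "smooth_map_on (I i) (f' i)" for i
      unfolding f'_def using Suc.prems(1) by (rule smooth_map_on_derivative)
    show "nth_derivative (I i) n (f' i) (\<tau> i) = nth_derivative (I j) n (f' j) (\<tau> j)" if "n < m" for n i j
      unfolding f'_def nth_derivative_Suc_shift[symmetric] using that by (intro Suc.prems) simp
  qed
  show ?case
  proof (rule common_jet_SucI[OF _ _ jet])
    show "f i (\<tau> i) = f undefined (\<tau> undefined)" for i
      using Suc.prems(2)[of 0 i undefined] by simp
    show "\<forall>\<^sub>F t in near i. (f i has_vector_derivative f' i t) (at t within I i)" for i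
      using eventually_near_I
      by eventually_elim
        (simp only: f'_def smooth_map_on_has_vector_derivative[OF Suc.prems(1)])
  qed
qed simp

end

section \<open>Planes with a symplectic form\<close>

locale symplectic_plane =
  fixes \<omega> :: "'a::real_normed_vector \<Rightarrow> 'a \<Rightarrow> real"
  assumes dim_2: "dim (UNIV :: 'a set) = 2" and symplectic: "symplectic_form \<omega>"
begin

lemma bilinear: "bilinear \<omega>"
  using symplectic by (simp add: symplectic_form_def)

lemmas omega_simps = bilinear_ladd[OF bilinear] bilinear_radd[OF bilinear]
  bilinear_lmul[OF bilinear] bilinear_rmul[OF bilinear]
  bilinear_lneg[OF bilinear] bilinear_rneg[OF bilinear]
  bilinear_lsub[OF bilinear] bilinear_rsub[OF bilinear]
  bilinear_lzero[OF bilinear] bilinear_rzero[OF bilinear]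

lemma omega_self [simp]: "\<omega> x x = 0"
  using symplectic by (simp add: symplectic_form_def)

lemma omega_swap: "\<omega> y x = - \<omega> x y"
proof -
  have "\<omega> (x + y) (x + y) = \<omega> x y + \<omega> y x"
    unfolding bilinear_ladd[OF bilinear] bilinear_radd[OF bilinear] by simp
  then show ?thesis
    by simp
qed

lemma omega_nondegenerate:
  assumes "x \<noteq> 0"
  obtains y where "\<omega> x y = 1"
proof -
  obtain z where "\<omega> x z \<noteq> 0"
    using assms symplectic by (auto simp: symplectic_form_def)
  then have "\<omega> x (z /\<^sub>R \<omega> x z) = 1"
    by (simp add: omega_simps)
  then show thesis ..
qed

lemma spanning_pair: "\<exists>u v :: 'a. \<forall>x. \<exists>a b. x = a *\<^sub>R u + b *\<^sub>R v"
proof -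
  obtain B :: "'a set" where B: "independent B" "card B = 2" "UNIV \<subseteq> span B"
    using basis_exists[of "UNIV :: 'a set"] dim_2 by metis
  then obtain u v where "B = {u, v}"
    by (meson card_2_iff)
  then have "x \<in> span {u, v}" for x
    using B(3) by auto
  then have "\<exists>a b. x = a *\<^sub>R u + b *\<^sub>R v" for x
    unfolding span_breakdown_eq[of _ u] span_singleton image_iff
    by (auto simp: diff_eq_eq add.commute)
  then show ?thesis
    by blast
qed

text \<open>Three vectors of a plane are linearly dependent, and \<open>\<omega>\<close> supplies the coefficients. Through this
identity \<open>\<omega>\<close> serves as the coordinate system of the plane: if \<open>\<omega> p q = 1\<close>, then \<open>\<omega> x q\<close> and
\<open>\<omega> p x\<close> are the coordinates of \<open>x\<close>.\<close>

lemma three_vectors: "\<omega> x y *\<^sub>R z = \<omega> z y *\<^sub>R x + \<omega> x z *\<^sub>R y"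
proof -
  obtain u v :: 'a where uv: "\<And>x. \<exists>a b. x = a *\<^sub>R u + b *\<^sub>R v"
    using spanning_pair by auto
  obtain x1 x2 y1 y2 z1 z2 where xyz: "x = x1 *\<^sub>R u + x2 *\<^sub>R v" "y = y1 *\<^sub>R u + y2 *\<^sub>R v"
    "z = z1 *\<^sub>R u + z2 *\<^sub>R v"
    using uv by metis
  have swap: "\<omega> v u = - \<omega> u v"
    by (rule omega_swap)
  have omega: "\<omega> (a *\<^sub>R u + b *\<^sub>R v) (c *\<^sub>R u + d *\<^sub>R v) = (a * d - b * c) * \<omega> u v" for a b c d
    by (simp add: omega_simps swap left_diff_distrib)
  show ?thesis
    unfolding xyz omega by (simp add: algebra_simps)
qed

lemma omega_omega: "\<omega> p q * \<omega> x y = \<omega> x q * \<omega> p y - \<omega> y q * \<omega> p x"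
proof -
  have "\<omega> x (\<omega> p q *\<^sub>R y) = \<omega> x (\<omega> y q *\<^sub>R p + \<omega> p y *\<^sub>R q)"
    by (rule arg_cong[OF three_vectors, of "\<omega> x"])
  then show ?thesis
    using omega_swap[of p x] by (simp add: omega_simps)
qed

lemma coordinates:
  "\<omega> p q = 1 \<Longrightarrow> x = \<omega> x q *\<^sub>R p + \<omega> p x *\<^sub>R q"
  using three_vectors[of p q x] by simp

lemma parallel:
  assumes "\<omega> x y = 0" "x \<noteq> 0"
  obtains c where "y = c *\<^sub>R x"
proof -
  obtain z where "\<omega> x z = 1"
    using omega_nondegenerate[OF assms(2)] .
  then have "y = \<omega> y z *\<^sub>R x"
    using coordinates[of x z y] assms(1) by simp
  then show thesis ..
qed

lemma unit_basis: obtains p q :: 'a where "\<omega> p q = 1"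
proof -
  have "\<exists>x :: 'a. x \<noteq> 0"
  proof (rule ccontr)
    assume "\<not> ?thesis"
    then have "(UNIV :: 'a set) \<subseteq> {0}" by auto
    then have "dim (UNIV :: 'a set) \<le> card ({} :: 'a set)"
      by (intro dim_le_card) auto
    then show False
      using dim_2 by simp
  qed
  then obtain x :: 'a where "x \<noteq> 0"
    by blast
  then obtain y where "\<omega> x y = 1"
    by (rule omega_nondegenerate)
  then show thesis
    by (rule that)
qed

text \<open>All norms on a plane are equivalent: the given norm attains a positive minimum on the compact
Euclidean unit circle of the coordinates. This bounds the coordinates, hence \<open>\<omega>\<close>, and it later
provides a nondegenerate quadratic form below the squared norm.\<close>

lemma norm_ge_coordinates:
  assumes "\<omega> p q = 1"
  obtains m where "m > 0" "\<And>x y :: real. m * norm (x, y) \<le> norm (x *\<^sub>R p + y *\<^sub>R q)"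
proof -
  let ?N = "\<lambda>z :: real \<times> real. norm (fst z *\<^sub>R p + snd z *\<^sub>R q)"
  have "continuous_on (sphere 0 1) ?N"
    by (intro continuous_intros)
  moreover have "(1, 0) \<in> sphere (0 :: real \<times> real) 1"
    by simp
  ultimately obtain z0 where z0: "z0 \<in> sphere 0 1" "\<And>z. z \<in> sphere 0 1 \<Longrightarrow> ?N z0 \<le> ?N z"
    using continuous_attains_inf[OF compact_sphere, of 0 1 ?N] by blast
  have "?N z0 \<noteq> 0"
  proof
    assume "?N z0 = 0"
    then have *: "fst z0 *\<^sub>R p + snd z0 *\<^sub>R q = 0"
      by simp
    have "fst z0 = \<omega> (fst z0 *\<^sub>R p + snd z0 *\<^sub>R q) q" "snd z0 = \<omega> p (fst z0 *\<^sub>R p + snd z0 *\<^sub>R q)"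
      by (simp_all only: omega_simps omega_self assms) simp_all
    then have "z0 = 0"
      unfolding * by (simp add: omega_simps prod_eq_iff)
    with z0(1) show False
      by simp
  qed
  then have pos: "?N z0 > 0"
    by simp
  have "?N z0 * norm (x, y) \<le> norm (x *\<^sub>R p + y *\<^sub>R q)" for x y
  proof (cases "(x, y) = (0 :: real \<times> real)")
    case False
    define n where "n = norm (x, y)"
    have n: "n > 0"
      using False unfolding n_def by simp
    have "norm ((x, y) /\<^sub>R n) = 1"
      unfolding norm_scaleR n_def[symmetric] using n by simp
    then have "(x, y) /\<^sub>R n \<in> sphere 0 1"
      by (simp only: mem_sphere_0)
    from z0(2)[OF this] have "?N z0 \<le> norm ((x *\<^sub>R p + y *\<^sub>R q) /\<^sub>R n)"
      by (simp add: scaleR_right_distrib)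
    also have "\<dots> = norm (x *\<^sub>R p + y *\<^sub>R q) / n"
      unfolding norm_scaleR using n by (simp add: divide_inverse mult.commute)
    finally show ?thesis
      unfolding n_def[symmetric] using n by (simp add: pos_le_divide_eq)
  qed (simp add: zero_prod_def)
  with pos show thesis
    by (rule that)
qed

lemma bounded_bilinear: "bounded_bilinear \<omega>"
proof
  obtain p q where pq: "\<omega> p q = 1"
    by (rule unit_basis)
  obtain m where m: "m > 0" "\<And>x y. m * norm (x, y) \<le> norm (x *\<^sub>R p + y *\<^sub>R q)"
    by (rule norm_ge_coordinates[OF pq]) blast
  have bound: "\<bar>\<omega> x q\<bar> \<le> norm x / m" "\<bar>\<omega> p x\<bar> \<le> norm x / m" for x
  proof -
    have "m * norm (\<omega> x q, \<omega> p x) \<le> norm x"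
      using m(2)[of "\<omega> x q" "\<omega> p x"] coordinates[OF pq, of x] by simp
    then have "norm (\<omega> x q, \<omega> p x) \<le> norm x / m"
      using m(1) by (simp add: field_simps)
    then show "\<bar>\<omega> x q\<bar> \<le> norm x / m" "\<bar>\<omega> p x\<bar> \<le> norm x / m"
      using norm_fst_le[of "\<omega> x q" "\<omega> p x"] norm_snd_le[of "\<omega> p x" "\<omega> x q"] by simp_all
  qed
  show "\<exists>K. \<forall>x y. norm (\<omega> x y) \<le> norm x * norm y * K"
  proof (intro exI allI)
    fix x y
    have "\<omega> x y = \<omega> x q * \<omega> p y - \<omega> y q * \<omega> p x"
      using omega_omega[of p q x y] pq by simp
    also have "\<bar>\<dots>\<bar> \<le> \<bar>\<omega> x q\<bar> * \<bar>\<omega> p y\<bar> + \<bar>\<omega> y q\<bar> * \<bar>\<omega> p x\<bar>"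
      by (simp add: abs_mult[symmetric])
    also have "\<dots> \<le> norm x / m * (norm y / m) + norm y / m * (norm x / m)"
      by (intro add_mono mult_mono bound) (use m(1) in auto)
    also have "\<dots> = norm x * norm y * (2 / m\<^sup>2)"
      by (simp add: power2_eq_square field_simps)
    finally show "norm (\<omega> x y) \<le> norm x * norm y * (2 / m\<^sup>2)"
      by simp
  qed
qed (simp_all add: omega_simps)

lemmas bounded_linear_left = bounded_bilinear.bounded_linear_left[OF bounded_bilinear]
lemmas bounded_linear_right = bounded_bilinear.bounded_linear_right[OF bounded_bilinear]

lemma continuous_on_omega [continuous_intros]:
  "continuous_on S f \<Longrightarrow> continuous_on S g \<Longrightarrow> continuous_on S (\<lambda>x. \<omega> (f x) (g x))"
  by (rule bounded_bilinear.continuous_on[OF bounded_bilinear])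

end

section \<open>Polar coordinates in a smooth plane\<close>

locale smooth_plane = symplectic_plane \<omega>
  for \<omega> :: "'a::real_normed_vector \<Rightarrow> 'a \<Rightarrow> real" +
  fixes \<phi> \<phi>' :: "real \<Rightarrow> 'a"
  assumes smooth: "smooth_map_on UNIV \<phi>"
    and smooth': "smooth_map_on UNIV \<phi>'"
    and phi_derivative: "(\<phi> has_vector_derivative \<phi>' s) (at s)"
    and phi'_nonzero: "\<phi>' s \<noteq> 0"
    and range_phi: "range \<phi> = sphere 0 1"
begin

text \<open>Twice the rate at which the radius to \<open>\<phi> s\<close> sweeps out area, as measured by \<open>\<omega>\<close>.\<close>

abbreviation w :: "real \<Rightarrow> real" where
  "w s \<equiv> \<omega> (\<phi> s) (\<phi>' s)"

lemma norm_phi [simp]: "norm (\<phi> s) = 1"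
proof -
  have "\<phi> s \<in> sphere 0 1"
    unfolding range_phi[symmetric] by simp
  then show ?thesis
    by simp
qed

lemma phi_nonzero: "\<phi> s \<noteq> 0"
  using norm_phi[of s] by force

lemma unit_vector_eq_phi:
  assumes "norm x = 1"
  obtains s where "x = \<phi> s"
proof -
  have "x \<in> range \<phi>"
    unfolding range_phi using assms by simp
  then show thesis
    using that by blast
qed

lemma continuous_on_phi [continuous_intros]:
  "continuous_on S f \<Longrightarrow> continuous_on S (\<lambda>x. \<phi> (f x))"
  by (rule continuous_on_compose2[OF continuous_on_vector_derivative[of UNIV, OF phi_derivative]]) auto

lemma continuous_on_phi' [continuous_intros]:
  "continuous_on S f \<Longrightarrow> continuous_on S (\<lambda>x. \<phi>' (f x))"
  by (rule continuous_on_compose2[OF continuous_on_vector_derivative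
        [OF smooth_map_on_has_vector_derivative[OF smooth']]]) auto

text \<open>The tangent line and the unit circle agree to first order, and the norm is constant on the circle
and Lipschitz.\<close>

lemma norm_tangent_derivative:
  "((\<lambda>h. norm (\<phi> s + h *\<^sub>R \<phi>' s)) has_real_derivative 0) (at 0)"
proof -
  have "((\<lambda>h. norm (\<phi> (s + h) - \<phi> s - h *\<^sub>R \<phi>' s) / norm h) \<longlongrightarrow> 0) (at 0)"
    using phi_derivative[of s] unfolding has_vector_derivative_def has_derivative_at by blast
  then have "((\<lambda>h. (norm (\<phi> s + h *\<^sub>R \<phi>' s) - 1) / h) \<longlongrightarrow> 0) (at 0)"
  proof (rule Lim_null_comparison[rotated])
    show "\<forall>\<^sub>F h in at 0. norm ((norm (\<phi> s + h *\<^sub>R \<phi>' s) - 1) / h)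
        \<le> norm (\<phi> (s + h) - \<phi> s - h *\<^sub>R \<phi>' s) / norm h"
    proof (rule always_eventually, rule allI)
      fix h
      have "\<bar>norm (\<phi> s + h *\<^sub>R \<phi>' s) - norm (\<phi> (s + h))\<bar> \<le> norm (\<phi> s + h *\<^sub>R \<phi>' s - \<phi> (s + h))"
        by (rule norm_triangle_ineq3)
      also have "\<dots> = norm (\<phi> (s + h) - \<phi> s - h *\<^sub>R \<phi>' s)"
        by (metis diff_diff_eq norm_minus_commute)
      finally show "norm ((norm (\<phi> s + h *\<^sub>R \<phi>' s) - 1) / h)
          \<le> norm (\<phi> (s + h) - \<phi> s - h *\<^sub>R \<phi>' s) / norm h"
        by (simp add: divide_right_mono)
    qed
  qed
  then show ?thesis
    by (simp add: DERIV_def)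
qed

text \<open>Along the tangent line the norm is a convex function whose derivative vanishes at the point of
contact, so the norm is minimal there.\<close>

lemma birkhoff_tangent: "\<phi> s \<stileturn>\<^sub>B \<phi>' s"
  unfolding birkhoff_orthogonal_def
proof
  fix h :: real
  let ?g = "\<lambda>h. norm (\<phi> s + h *\<^sub>R \<phi>' s)"
  have "convex_on UNIV ?g"
  proof (rule convex_onI)
    fix t x y :: real
    assume t: "0 < t" "t < 1"
    have "\<phi> s + ((1 - t) *\<^sub>R x + t *\<^sub>R y) *\<^sub>R \<phi>' s
      = (1 - t) *\<^sub>R (\<phi> s + x *\<^sub>R \<phi>' s) + t *\<^sub>R (\<phi> s + y *\<^sub>R \<phi>' s)"
      by (simp add: algebra_simps)
    then show "?g ((1 - t) *\<^sub>R x + t *\<^sub>R y) \<le> (1 - t) * ?g x + t * ?g y"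
      using t norm_triangle_ineq[of "(1 - t) *\<^sub>R (\<phi> s + x *\<^sub>R \<phi>' s)" "t *\<^sub>R (\<phi> s + y *\<^sub>R \<phi>' s)"]
      by simp
  qed simp
  from convex_on_imp_above_tangent[OF this, of 0 h 0] norm_tangent_derivative[of s]
  show "norm (\<phi> s + h *\<^sub>R \<phi>' s) \<ge> norm (\<phi> s)"
    by simp
qed

lemma w_nonzero: "w s \<noteq> 0"
proof
  assume "w s = 0"
  then obtain c where c: "\<phi>' s = c *\<^sub>R \<phi> s"
    using parallel phi_nonzero by metis
  then have "c \<noteq> 0"
    using phi'_nonzero[of s] by auto
  then have "\<phi> s + (- 1 / c) *\<^sub>R \<phi>' s = 0"
    unfolding c by simp
  then show False
    using birkhoff_tangent[of s] unfolding birkhoff_orthogonal_def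
    by (metis norm_phi norm_zero not_one_le_zero)
qed

text \<open>The tangent never points along the radius, so \<open>w\<close> has no zero; being continuous, it has one sign.
Thus \<open>\<phi>\<close> runs around the circle in one sense.\<close>

lemma w_same_sign: "w s * w s' > 0"
proof -
  have interval: "is_interval (range w)"
    by (unfold is_interval_connected_1, intro connected_continuous_image continuous_intros connected_UNIV
        continuous_on_id)
  have no_change: "\<not> (w a \<le> 0 \<and> 0 \<le> w b)" for a b
  proof
    assume "w a \<le> 0 \<and> 0 \<le> w b"
    then have "0 \<in> range w"
      using interval[unfolded is_interval_1, rule_format, of "w a" "w b" 0] by blast
    then obtain c where "0 = w c"
      by (rule rangeE)
    then show False
      using w_nonzero[of c] by simp
  qed
  show ?thesis
    using no_change[of s s'] no_change[of s' s] by (auto simp: zero_less_mult_iff not_le)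
qed

lemma sgn_w: "sgn (w s) = sgn (w s')"
  using w_same_sign[of s s'] by (auto simp: zero_less_mult_iff)

text \<open>Near a given nonzero vector, a vector is determined by its norm and an angle \<open>A\<close>, the parameter of
its direction on the circle. The slope \<open>\<omega> p x / \<omega> x q\<close> in the basis \<open>p = \<phi> s\<^sub>0\<close>, \<open>q = \<phi>' s\<^sub>0\<close>
depends on the direction only, and along \<open>\<phi>\<close> it is, near \<open>s\<^sub>0\<close>, a strictly increasing function
\<open>a\<close> of the parameter; \<open>A\<close> is the inverse of \<open>a\<close> applied to the slope. Once the norm and the
angle are known to be differentiable, their derivatives follow by applying \<open>\<omega> _ (\<phi>' (A x))\<close> and
\<open>\<omega> (\<phi> (A x))\<close> to the derivative of \<open>x = norm x *\<^sub>R \<phi> (A x)\<close>. These formulas contain no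
derivative of the norm or of the angle, only their values, which makes induction on the order of
contact possible.\<close>

lemma polar_coordinates:
  assumes "r > 0"
  obtains U A where "open U" "r *\<^sub>R \<phi> s\<^sub>0 \<in> U" "A (r *\<^sub>R \<phi> s\<^sub>0) = s\<^sub>0" "\<And>x. x \<in> U \<Longrightarrow> x = norm x *\<^sub>R \<phi> (A x)" "\<And>x. x \<in> U \<Longrightarrow> x \<noteq> 0"
    "\<And>x. x \<in> U \<Longrightarrow> (norm has_derivative (\<lambda>y. \<omega> y (\<phi>' (A x)) / w (A x))) (at x)"
    "\<And>x. x \<in> U \<Longrightarrow> (A has_derivative (\<lambda>y. \<omega> (\<phi> (A x)) y / (norm x * w (A x)))) (at x)"
proof -
  define p q W where "p = \<phi> s\<^sub>0" "q = \<phi>' s\<^sub>0" "W = \<omega> p q"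
  have W: "W \<noteq> 0"
    unfolding p_q_W_def by (rule w_nonzero)
  have pq: "W *\<^sub>R x = \<omega> x q *\<^sub>R p + \<omega> p x *\<^sub>R q" for x
    unfolding p_q_W_def by (rule three_vectors)
  define a where "a s = \<omega> p (\<phi> s) / \<omega> (\<phi> s) q" for s
  have "open {s. 0 < \<omega> (\<phi> s) q * W}"
    by (intro open_Collect_less continuous_intros)
  moreover have "s\<^sub>0 \<in> {s. 0 < \<omega> (\<phi> s) q * W}"
    using W unfolding p_q_W_def by (simp add: zero_less_mult_iff) linarith
  ultimately obtain \<delta> where \<delta>: "\<delta> > 0" "ball s\<^sub>0 \<delta> \<subseteq> {s. 0 < \<omega> (\<phi> s) q * W}"
    using open_contains_ball by blast
  define S where "S = ball s\<^sub>0 \<delta>"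
  have q_pos: "0 < \<omega> (\<phi> s) q * W" if "s \<in> S" for s
    using \<delta> that unfolding S_def by blast
  have a_deriv: "(a has_real_derivative W * w s / (\<omega> (\<phi> s) q)\<^sup>2) (at s)" if "s \<in> S" for s
  proof -
    have "((\<lambda>s. \<omega> p (\<phi> s)) has_real_derivative \<omega> p (\<phi>' s)) (at s)"
      "((\<lambda>s. \<omega> (\<phi> s) q) has_real_derivative \<omega> (\<phi>' s) q) (at s)"
      unfolding has_real_derivative_iff_has_vector_derivative
      by (intro bounded_linear.has_vector_derivative[OF bounded_linear_right]
          bounded_linear.has_vector_derivative[OF bounded_linear_left] phi_derivative)+
    moreover have "\<omega> (\<phi> s) q \<noteq> 0"
      using q_pos[OF that] by auto
    \<comment> \<open>The Pluecker relation identifies the numerator given by the quotient rule.\<close>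
    moreover have "W * w s = \<omega> p (\<phi>' s) * \<omega> (\<phi> s) q - \<omega> p (\<phi> s) * \<omega> (\<phi>' s) q"
      using omega_omega[of p q "\<phi> s" "\<phi>' s"] unfolding p_q_W_def(3) by (simp add: mult.commute)
    ultimately show ?thesis
      unfolding a_def by (auto intro!: derivative_eq_intros simp: power2_eq_square)
  qed
  have a'_pos: "W * w s / (\<omega> (\<phi> s) q)\<^sup>2 > 0" if "s \<in> S" for s
    using w_same_sign[of s\<^sub>0 s] q_pos[OF that] unfolding p_q_W_def
    by (intro divide_pos_pos) auto
  have mono: "a s < a s'" if "s < s'" "s \<in> S" "s' \<in> S" for s s'
  proof (rule DERIV_pos_imp_increasing[OF that(1)])
    fix r assume "s \<le> r" "r \<le> s'"
    then have "r \<in> S"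
      using that unfolding S_def by (auto simp: dist_real_def)
    then show "\<exists>y. (a has_real_derivative y) (at r) \<and> 0 < y"
      using a_deriv a'_pos by blast
  qed
  have inj: "inj_on a S"
  proof (rule inj_onI)
    fix s s' assume "s \<in> S" "s' \<in> S" "a s = a s'"
    then show "s = s'"
      using mono[of s s'] mono[of s' s] by (cases s s' rule: linorder_cases) auto
  qed
  have cont: "continuous_on S a"
    by (rule DERIV_continuous_on) (rule has_field_derivative_at_within[OF a_deriv])
  have "open S"
    unfolding S_def by simp
  then have open_aS: "open (a ` S)"
    by (rule invariance_of_domain[OF cont _ inj])
  define g where "g = inv_into S a"
  have ga: "g (a s) = s" if "s \<in> S" for s
    unfolding g_def using inj that by simp
  have g_diff: "g differentiable (at r)" if r: "r \<in> a ` S" for r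
  proof -
    obtain s where s: "s \<in> S" "r = a s"
      using r by blast
    have "(g has_derivative (*) (inverse (W * w s / (\<omega> (\<phi> s) q)\<^sup>2))) (at (a s))"
    proof (rule has_derivative_inverse_strong[OF \<open>open S\<close> s(1) cont ga])
      show "(a has_derivative (*) (W * w s / (\<omega> (\<phi> s) q)\<^sup>2)) (at s)"
        using a_deriv[OF s(1)] by (simp add: has_field_derivative_def)
      show "(*) (W * w s / (\<omega> (\<phi> s) q)\<^sup>2) \<circ> (*) (inverse (W * w s / (\<omega> (\<phi> s) q)\<^sup>2)) = id"
        using a'_pos[OF s(1)] by (auto simp: fun_eq_iff)
    qed
    then show ?thesis
      unfolding s(2) differentiable_def by blast
  qed
  define D where "D = {x. 0 < \<omega> x q * W}"
  define U where "U = D \<inter> (\<lambda>x. \<omega> p x / \<omega> x q) -` (a ` S)"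
  define A where "A x = g (\<omega> p x / \<omega> x q)" for x
  have "continuous_on D (\<lambda>x. \<omega> p x / \<omega> x q)"
    unfolding D_def by (intro continuous_intros) auto
  moreover have "open D"
    unfolding D_def by (intro open_Collect_less continuous_intros)
  ultimately have "open U"
    unfolding U_def by (rule continuous_open_preimage[OF _ _ open_aS])
  have s\<^sub>0: "a s\<^sub>0 = 0" "s\<^sub>0 \<in> S"
    using \<delta>(1) by (simp_all add: a_def p_q_W_def S_def)
  have x\<^sub>0: "\<omega> (r *\<^sub>R \<phi> s\<^sub>0) q = r * W" "\<omega> p (r *\<^sub>R \<phi> s\<^sub>0) = 0"
    by (simp_all add: omega_simps p_q_W_def)
  have "0 < r * (W * W)"
    using mult_pos_pos[OF assms, of "W * W"] W not_real_square_gt_zero[of W] by blast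
  then have "r *\<^sub>R \<phi> s\<^sub>0 \<in> D"
    unfolding D_def by (simp add: x\<^sub>0 mult.assoc)
  then have x\<^sub>0_U: "r *\<^sub>R \<phi> s\<^sub>0 \<in> U"
    unfolding U_def using imageI[OF s\<^sub>0(2), of a] by (simp add: x\<^sub>0 s\<^sub>0(1))
  have A_x\<^sub>0: "A (r *\<^sub>R \<phi> s\<^sub>0) = s\<^sub>0"
    unfolding A_def using ga[OF s\<^sub>0(2)] by (simp add: x\<^sub>0 s\<^sub>0)
  have polar: "norm x = \<omega> x q / \<omega> (\<phi> (A x)) q" "x = norm x *\<^sub>R \<phi> (A x)" "x \<noteq> 0" "\<omega> (\<phi> (A x)) q \<noteq> 0"
    "\<omega> x q \<noteq> 0" if x: "x \<in> U" for x
  proof -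
    obtain s where s: "s \<in> S" "\<omega> p x / \<omega> x q = a s"
      using x unfolding U_def by blast
    then have Ax: "A x = s"
      unfolding A_def by (simp add: ga)
    \<comment> \<open>The ratio of the first coordinates of \<open>x\<close> and \<open>\<phi> s\<close>. It is also the ratio of the second ones, since the slopes agree.\<close>
    define \<rho> where "\<rho> = \<omega> x q / \<omega> (\<phi> s) q"
    have pos: "\<omega> x q * W > 0" "\<omega> (\<phi> s) q * W > 0"
      using x q_pos[OF s(1)] unfolding U_def D_def by auto
    then have nz: "\<omega> x q \<noteq> 0" "\<omega> (\<phi> s) q \<noteq> 0"
      by auto
    have "\<rho> > 0"
      unfolding \<rho>_def using pos by (auto simp: zero_less_mult_iff zero_less_divide_iff)
    have "\<omega> x q = \<rho> * \<omega> (\<phi> s) q" "\<omega> p x = \<rho> * \<omega> p (\<phi> s)"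
      using s(2) nz unfolding \<rho>_def a_def by (simp_all add: field_simps)
    then have "W *\<^sub>R x = \<rho> *\<^sub>R W *\<^sub>R \<phi> s"
      unfolding pq by (simp add: scaleR_right_distrib)
    then have "W *\<^sub>R x = W *\<^sub>R \<rho> *\<^sub>R \<phi> s"
      by (simp add: mult.commute)
    then have x_eq: "x = \<rho> *\<^sub>R \<phi> s"
      unfolding scaleR_cancel_left using W by blast
    have norm_x: "norm x = \<rho>"
      using \<open>\<rho> > 0\<close> arg_cong[OF x_eq, of norm] by simp
    show "norm x = \<omega> x q / \<omega> (\<phi> (A x)) q" "x = norm x *\<^sub>R \<phi> (A x)" "x \<noteq> 0"
      "\<omega> (\<phi> (A x)) q \<noteq> 0" "\<omega> x q \<noteq> 0"
      unfolding Ax using norm_x \<rho>_def x_eq \<open>\<rho> > 0\<close> nz by (metis, metis, metis norm_zero less_irrefl, metis, metis)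
  qed
  have deriv: "(norm has_derivative (\<lambda>y. \<omega> y (\<phi>' (A x)) / w (A x))) (at x)
    \<and> (A has_derivative (\<lambda>y. \<omega> (\<phi> (A x)) y / (norm x * w (A x)))) (at x)" if x: "x \<in> U" for x
  proof -
    note left = bounded_linear_imp_has_derivative[OF bounded_linear_left]
    note right = bounded_linear_imp_has_derivative[OF bounded_linear_right]
    have "(\<lambda>x. \<omega> p x / \<omega> x q) differentiable (at x)"
      by (rule differentiable_divide[OF differentiableI[OF right] differentiableI[OF left] polar(5)[OF x]])
    moreover have "g differentiable (at (\<omega> p x / \<omega> x q))"
      using x g_diff unfolding U_def by blast
    ultimately have "(g \<circ> (\<lambda>x. \<omega> p x / \<omega> x q)) differentiable (at x)"
      by (intro differentiable_chain_at)
    then have "A differentiable (at x)"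
      unfolding A_def comp_def .
    then obtain A' where A': "(A has_derivative A') (at x)"
      unfolding differentiable_def by blast
    have phiA: "((\<lambda>x. \<phi> (A x)) has_derivative (\<lambda>y. A' y *\<^sub>R \<phi>' (A x))) (at x)"
      using has_derivative_compose[OF A' phi_derivative[of "A x", unfolded has_vector_derivative_def]] .
    have "(\<lambda>x. \<omega> x q / \<omega> (\<phi> (A x)) q) differentiable (at x)"
      by (rule differentiable_divide[OF differentiableI[OF left]
            differentiableI[OF has_derivative_compose[OF phiA left]] polar(4)[OF x]])
    then obtain R where R: "((\<lambda>x. \<omega> x q / \<omega> (\<phi> (A x)) q) has_derivative R) (at x)"
      unfolding differentiable_def by blast
    have R: "(norm has_derivative R) (at x)"
      by (rule has_derivative_transform_within_open[OF R \<open>open U\<close> x]) (simp add: polar(1)[symmetric])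
    have "((\<lambda>x. norm x *\<^sub>R \<phi> (A x)) has_derivative (\<lambda>y. norm x *\<^sub>R A' y *\<^sub>R \<phi>' (A x) + R y *\<^sub>R \<phi> (A x))) (at x)"
      using has_derivative_scaleR[OF R phiA] .
    then have "((\<lambda>x. x) has_derivative (\<lambda>y. norm x *\<^sub>R A' y *\<^sub>R \<phi>' (A x) + R y *\<^sub>R \<phi> (A x))) (at x)"
      by (rule has_derivative_transform_within_open[OF _ \<open>open U\<close> x]) (simp add: polar(2)[symmetric])
    then have "(\<lambda>y. y) = (\<lambda>y. norm x *\<^sub>R A' y *\<^sub>R \<phi>' (A x) + R y *\<^sub>R \<phi> (A x))"
      by (rule has_derivative_unique[OF has_derivative_ident])
    then have y: "y = norm x *\<^sub>R A' y *\<^sub>R \<phi>' (A x) + R y *\<^sub>R \<phi> (A x)" for y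
      by metis
    have eqs: "\<omega> y (\<phi>' (A x)) = R y * w (A x)" "\<omega> (\<phi> (A x)) y = A' y * (norm x * w (A x))" for y
      using arg_cong[OF y[of y], of "\<lambda>z. \<omega> z (\<phi>' (A x))"] arg_cong[OF y[of y], of "\<omega> (\<phi> (A x))"]
      by (simp_all only: omega_simps omega_self mult_zero_right add_0_left add_0_right
          mult.left_commute[of _ "A' y"] real_scaleR_def)
    have nz: "norm x * w (A x) \<noteq> 0"
      using w_nonzero polar(3)[OF x] by simp
    have "A' = (\<lambda>y. \<omega> (\<phi> (A x)) y / (norm x * w (A x)))"
    proof
      show "A' y = \<omega> (\<phi> (A x)) y / (norm x * w (A x))" for y
        unfolding eqs(2)[of y] by (rule nonzero_mult_div_cancel_right[OF nz, symmetric])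
    qed
    moreover have "R = (\<lambda>y. \<omega> y (\<phi>' (A x)) / w (A x))"
    proof
      show "R y = \<omega> y (\<phi>' (A x)) / w (A x)" for y
        unfolding eqs(1)[of y] by (rule nonzero_mult_div_cancel_right[OF w_nonzero, symmetric])
    qed
    ultimately show ?thesis
      using R A' by (intro conjI) (erule subst, assumption)+
  qed
  show thesis
    by (rule that[of U A]) (fact \<open>open U\<close> x\<^sub>0_U A_x\<^sub>0 polar(2,3) conjunct1[OF deriv] conjunct2[OF deriv])+
qed

lemma norm_has_derivative_phi: "(norm has_derivative (\<lambda>y. \<omega> y (\<phi>' s) / w s)) (at (\<phi> s))"
proof -
  obtain U A where U: "1 *\<^sub>R \<phi> s \<in> U" and A: "A (1 *\<^sub>R \<phi> s) = s"
    and deriv: "\<And>x. x \<in> U \<Longrightarrow> (norm has_derivative (\<lambda>y. \<omega> y (\<phi>' (A x)) / w (A x))) (at x)"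
    by (rule polar_coordinates[OF zero_less_one]) blast
  show ?thesis
    using deriv[OF U] A by simp
qed

text \<open>The direction \<open>b\<close> is the normalised tangent, oriented by \<open>\<omega>\<close>. For uniqueness: if \<open>\<phi> s\<close> is orthogonal
to \<open>b\<close>, then the norm on the line through \<open>\<phi> s\<close> in direction \<open>b\<close> has a minimum at \<open>\<phi> s\<close>, so the
derivative \<open>\<omega> b (\<phi>' s) / w s\<close> vanishes and \<open>b\<close> is parallel to \<open>\<phi>' s\<close>.\<close>

lemma birkhoff_dir_phi: "birkhoff_dir \<omega> (\<phi> s) = (sgn (w s) / norm (\<phi>' s)) *\<^sub>R \<phi>' s"
  unfolding birkhoff_dir_def
proof (rule the_equality)
  let ?b = "(sgn (w s) / norm (\<phi>' s)) *\<^sub>R \<phi>' s"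
  have "sgn (w s) * w s > 0"
    using w_nonzero[of s] by (cases "w s > 0") auto
  then have "\<omega> (\<phi> s) ?b > 0"
    using phi'_nonzero[of s] by (simp add: omega_simps)
  moreover have "\<phi> s \<stileturn>\<^sub>B ?b"
    using birkhoff_tangent[of s] unfolding birkhoff_orthogonal_def by (metis scaleR_scaleR)
  moreover have "norm ?b = 1"
    using w_nonzero[of s] phi'_nonzero[of s] by (simp add: abs_sgn_eq)
  ultimately show "?b \<in> sphere 0 1 \<and> \<phi> s \<stileturn>\<^sub>B ?b \<and> \<omega> (\<phi> s) ?b > 0"
    by simp
next
  fix b
  assume b: "b \<in> sphere 0 1 \<and> \<phi> s \<stileturn>\<^sub>B b \<and> \<omega> (\<phi> s) b > 0"
  let ?k = "\<lambda>t::real. norm (\<phi> s + t *\<^sub>R b)"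
  have "((\<lambda>t::real. \<phi> s + t *\<^sub>R b) has_derivative (\<lambda>t. t *\<^sub>R b)) (at 0)"
    by (auto intro!: derivative_eq_intros)
  then have "(?k has_derivative (\<lambda>t. \<omega> (t *\<^sub>R b) (\<phi>' s) / w s)) (at 0)"
    by (rule has_derivative_compose) (simp add: norm_has_derivative_phi)
  then have "(?k has_real_derivative \<omega> b (\<phi>' s) / w s) (at 0)"
    by (rule has_derivative_imp_has_field_derivative) (simp add: omega_simps)
  then have "\<omega> b (\<phi>' s) / w s = 0"
    by (rule DERIV_local_min[where d = 1]) (use b in \<open>auto simp: birkhoff_orthogonal_def\<close>)
  then have "\<omega> (\<phi>' s) b = 0"
    using omega_swap w_nonzero by (metis divide_eq_0_iff neg_equal_0_iff_equal)
  then obtain c where c: "b = c *\<^sub>R \<phi>' s"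
    using parallel phi'_nonzero by metis
  have "\<bar>c\<bar> = 1 / norm (\<phi>' s)" "c * w s > 0"
    using b phi'_nonzero[of s] unfolding c by (auto simp: omega_simps field_simps)
  then have "c = sgn (w s) / norm (\<phi>' s)"
    by (auto simp: sgn_if zero_less_mult_iff)
  then show "b = (sgn (w s) / norm (\<phi>' s)) *\<^sub>R \<phi>' s"
    unfolding c by simp
qed

end

section \<open>Jets of the curvature pair\<close>

locale plane_curves = smooth_plane \<omega> \<phi> \<phi>' + interval_family I \<tau>
  for \<omega> :: "'a::real_normed_vector \<Rightarrow> 'a \<Rightarrow> real" and \<phi> \<phi>'
    and I :: "'i \<Rightarrow> real set" and \<tau>
begin

lemmas common_jet_omega = common_jet_bilinear[OF bounded_bilinear]

text \<open>The derivatives of the norm and the angle along a curve \<open>c\<close> are rational expressions in the norm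
and the angle themselves, \<open>c'\<close>, and smooth functions of the angle. A common jet of \<open>c\<close> thus passes
to the norm and the angle, one order at a time, and simultaneously, because the derivative of the
angle involves both.\<close>

lemma common_jet_polar:
  assumes "open U" and U: "r *\<^sub>R \<phi> s\<^sub>0 \<in> U"
    and nonzero: "\<And>x. x \<in> U \<Longrightarrow> x \<noteq> 0"
    and norm: "\<And>x. x \<in> U \<Longrightarrow> (norm has_derivative (\<lambda>y. \<omega> y (\<phi>' (A x)) / w (A x))) (at x)"
    and A: "\<And>x. x \<in> U \<Longrightarrow>
      (A has_derivative (\<lambda>y. \<omega> (\<phi> (A x)) y / (norm x * w (A x)))) (at x)"
    and base: "\<And>i. c i (\<tau> i) = r *\<^sub>R \<phi> s\<^sub>0"
  shows "common_jet m I \<tau> c \<Longrightarrow>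
    common_jet m I \<tau> (\<lambda>i t. norm (c i t)) \<and> common_jet m I \<tau> (\<lambda>i t. A (c i t))"
proof (induction m)
  case (Suc m)
  obtain c' where c': "\<And>i. \<forall>\<^sub>F t in near i. (c i has_vector_derivative c' i t) (at t within I i)"
    and jet_c': "common_jet m I \<tau> c'"
    using Suc.prems by (rule common_jet_SucE) blast
  have IH: "common_jet m I \<tau> (\<lambda>i t. norm (c i t))" "common_jet m I \<tau> (\<lambda>i t. A (c i t))"
    using Suc.IH common_jet_Suc_imp[OF Suc.prems] by auto
  note phi = common_jet_compose_smooth[OF smooth IH(2)] common_jet_compose_smooth[OF smooth' IH(2)]
  have w: "common_jet m I \<tau> (\<lambda>i t. w (A (c i t)))"
    by (intro common_jet_omega phi)
  have "common_jet m I \<tau> (\<lambda>i t. \<omega> (c' i t) (\<phi>' (A (c i t))) * inverse (w (A (c i t))))"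
    by (intro common_jet_mult common_jet_inverse w w_nonzero common_jet_omega jet_c' phi)
  then have 1: "common_jet m I \<tau> (\<lambda>i t. \<omega> (c' i t) (\<phi>' (A (c i t))) / w (A (c i t)))"
    by (simp only: divide_inverse)
  have "norm (c i (\<tau> i)) * w (A (c i (\<tau> i))) \<noteq> 0" for i
    using nonzero[OF U] w_nonzero by (simp add: base)
  then have "common_jet m I \<tau> (\<lambda>i t. \<omega> (\<phi> (A (c i t))) (c' i t) * inverse (norm (c i t) * w (A (c i t))))"
    by (intro common_jet_mult common_jet_inverse w common_jet_omega jet_c' phi IH)
  then have 2: "common_jet m I \<tau> (\<lambda>i t. \<omega> (\<phi> (A (c i t))) (c' i t) / (norm (c i t) * w (A (c i t))))"
    by (simp only: divide_inverse)
  have near_U: "\<forall>\<^sub>F t in near i. c i t \<in> U" for i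
    by (rule eventually_near_within_continuous[OF eventually_near_within_self[OF c' base_point] \<open>open U\<close>])
      (simp add: base U)
  show ?case
  proof
    show "common_jet (Suc m) I \<tau> (\<lambda>i t. norm (c i t))"
    proof (rule common_jet_SucI[OF _ _ 1])
      show "\<forall>\<^sub>F t in near i. ((\<lambda>t. norm (c i t)) has_vector_derivative
          \<omega> (c' i t) (\<phi>' (A (c i t))) / w (A (c i t))) (at t within I i)" for i
        using c'[of i] near_U[of i]
      proof eventually_elim
        case (elim t)
        show ?case
          using vector_derivative_diff_chain_within[OF elim(1) has_derivative_at_withinI[OF norm[OF elim(2)]]]
          by (simp only: comp_def)
      qed
    qed (simp add: base)
    show "common_jet (Suc m) I \<tau> (\<lambda>i t. A (c i t))"
    proof (rule common_jet_SucI[OF _ _ 2])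
      show "\<forall>\<^sub>F t in near i. ((\<lambda>t. A (c i t)) has_vector_derivative
          \<omega> (\<phi> (A (c i t))) (c' i t) / (norm (c i t) * w (A (c i t)))) (at t within I i)" for i
        using c'[of i] near_U[of i]
      proof eventually_elim
        case (elim t)
        show ?case
          using vector_derivative_diff_chain_within[OF elim(1) has_derivative_at_withinI[OF A[OF elim(2)]]]
          by (simp only: comp_def)
      qed
    qed (simp add: base)
  qed
qed simp

lemma common_jet_norm:
  fixes x\<^sub>0 :: 'a
  assumes jet: "common_jet m I \<tau> c" and base: "\<And>i. c i (\<tau> i) = x\<^sub>0" and "x\<^sub>0 \<noteq> 0"
  shows "common_jet m I \<tau> (\<lambda>i t. norm (c i t))"
proof -
  have "norm (x\<^sub>0 /\<^sub>R norm x\<^sub>0) = 1"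
    using \<open>x\<^sub>0 \<noteq> 0\<close> by simp
  then obtain s\<^sub>0 where "x\<^sub>0 /\<^sub>R norm x\<^sub>0 = \<phi> s\<^sub>0"
    by (rule unit_vector_eq_phi)
  then have "norm x\<^sub>0 *\<^sub>R (x\<^sub>0 /\<^sub>R norm x\<^sub>0) = norm x\<^sub>0 *\<^sub>R \<phi> s\<^sub>0"
    by (rule arg_cong)
  then have x\<^sub>0: "x\<^sub>0 = norm x\<^sub>0 *\<^sub>R \<phi> s\<^sub>0"
    using \<open>x\<^sub>0 \<noteq> 0\<close> by simp
  have "0 < norm x\<^sub>0"
    using \<open>x\<^sub>0 \<noteq> 0\<close> by simp
  then obtain U A where U: "open U" "norm x\<^sub>0 *\<^sub>R \<phi> s\<^sub>0 \<in> U" "\<And>x. x \<in> U \<Longrightarrow> x \<noteq> 0"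
    "\<And>x. x \<in> U \<Longrightarrow> (norm has_derivative (\<lambda>y. \<omega> y (\<phi>' (A x)) / w (A x))) (at x)"
    "\<And>x. x \<in> U \<Longrightarrow> (A has_derivative (\<lambda>y. \<omega> (\<phi> (A x)) y / (norm x * w (A x)))) (at x)"
    by (rule polar_coordinates) blast
  have "c i (\<tau> i) = norm x\<^sub>0 *\<^sub>R \<phi> s\<^sub>0" for i
    unfolding base by (rule x\<^sub>0)
  from common_jet_polar[OF U this jet] show ?thesis
    by blast
qed

text \<open>The polar coordinates are used twice: for \<open>\<eta>\<close>, to write it as \<open>\<phi>\<close> of an angle, and for the tangent
\<open>\<phi>'\<close> at that angle, to see that its norm has a common jet as well.\<close>

lemma common_jet_birkhoff_dir:
  assumes jet: "common_jet m I \<tau> \<eta>" and unit: "\<And>i t. t \<in> I i \<Longrightarrow> norm (\<eta> i t) = 1"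
  shows "common_jet m I \<tau> (\<lambda>i t. birkhoff_dir \<omega> (\<eta> i t))"
proof (cases m)
  case (Suc n)
  obtain x\<^sub>0 \<eta>' where x\<^sub>0: "\<And>i. \<eta> i (\<tau> i) = x\<^sub>0"
    and \<eta>': "\<And>i. \<forall>\<^sub>F t in near i. (\<eta> i has_vector_derivative \<eta>' i t) (at t within I i)"
    using jet unfolding Suc by (rule common_jet_SucE) blast
  have "norm x\<^sub>0 = 1"
    using unit[OF base_point] x\<^sub>0 by metis
  then obtain s\<^sub>0 where s\<^sub>0: "x\<^sub>0 = \<phi> s\<^sub>0"
    by (rule unit_vector_eq_phi)
  obtain U A where U: "open U" "1 *\<^sub>R \<phi> s\<^sub>0 \<in> U" "\<And>x. x \<in> U \<Longrightarrow> x \<noteq> 0"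
    "\<And>x. x \<in> U \<Longrightarrow> (norm has_derivative (\<lambda>y. \<omega> y (\<phi>' (A x)) / w (A x))) (at x)"
    "\<And>x. x \<in> U \<Longrightarrow> (A has_derivative (\<lambda>y. \<omega> (\<phi> (A x)) y / (norm x * w (A x)))) (at x)"
    and A: "A (1 *\<^sub>R \<phi> s\<^sub>0) = s\<^sub>0" and polar: "\<And>x. x \<in> U \<Longrightarrow> x = norm x *\<^sub>R \<phi> (A x)"
    by (rule polar_coordinates[OF zero_less_one]) blast
  have base: "\<eta> i (\<tau> i) = 1 *\<^sub>R \<phi> s\<^sub>0" for i
    by (simp add: x\<^sub>0 s\<^sub>0)
  have jet_A: "common_jet m I \<tau> (\<lambda>i t. A (\<eta> i t))"
    using common_jet_polar[OF U base jet] by blast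
  have jet_\<phi>': "common_jet m I \<tau> (\<lambda>i t. \<phi>' (A (\<eta> i t)))"
    by (rule common_jet_compose_smooth[OF smooth' jet_A])
  have "\<phi>' (A (\<eta> i (\<tau> i))) = \<phi>' s\<^sub>0" for i
    unfolding base A ..
  note jet_norm = common_jet_norm[OF jet_\<phi>' this phi'_nonzero]
  have "common_jet m I \<tau> (\<lambda>i t. (sgn (w s\<^sub>0) * inverse (norm (\<phi>' (A (\<eta> i t))))) *\<^sub>R \<phi>' (A (\<eta> i t)))"
    by (intro common_jet_scaleR common_jet_mult common_jet_const common_jet_inverse jet_norm jet_\<phi>')
      (simp add: phi'_nonzero)
  then show ?thesis
  proof (rule common_jet_cong)
    fix i
    have "\<forall>\<^sub>F t in near i. \<eta> i t \<in> U"
      by (rule eventually_near_within_continuous[OF eventually_near_within_self[OF \<eta>' base_point] U(1)])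
        (simp only: base U(2))
    then show "\<forall>\<^sub>F t in near i. (sgn (w s\<^sub>0) * inverse (norm (\<phi>' (A (\<eta> i t))))) *\<^sub>R \<phi>' (A (\<eta> i t))
        = birkhoff_dir \<omega> (\<eta> i t)"
      using eventually_near_I
    proof eventually_elim
      case (elim t)
      have "\<eta> i t = \<phi> (A (\<eta> i t))"
        using polar[OF elim(1)] unit[OF elim(2)] by simp
      then have "birkhoff_dir \<omega> (\<eta> i t) = birkhoff_dir \<omega> (\<phi> (A (\<eta> i t)))"
        by (rule arg_cong)
      then show ?case
        by (simp only: birkhoff_dir_phi sgn_w[of "A (\<eta> i t)" s\<^sub>0] divide_inverse)
    qed
  qed
qed simp

lemma omega_birkhoff_dir_nonzero:
  assumes "norm x = 1"
  shows "\<omega> x (birkhoff_dir \<omega> x) \<noteq> 0"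
proof -
  obtain s where "x = \<phi> s"
    using assms by (rule unit_vector_eq_phi)
  then show ?thesis
    using w_nonzero[of s] phi'_nonzero[of s] by (simp add: birkhoff_dir_phi omega_simps sgn_zero_iff)
qed

text \<open>Applying \<open>\<omega> (\<eta> i t)\<close> to a multiple of the direction \<open>b\<close> recovers the coefficient, up to a factor
that never vanishes.\<close>

lemma common_jet_coefficient:
  assumes jet_\<eta>: "common_jet m I \<tau> \<eta>" and unit: "\<And>i t. t \<in> I i \<Longrightarrow> norm (\<eta> i t) = 1"
    and jet: "common_jet m I \<tau> (\<lambda>i t. \<alpha> i t *\<^sub>R birkhoff_dir \<omega> (\<eta> i t))"
  shows "common_jet m I \<tau> \<alpha>"
proof (rule common_jet_cong)
  show "common_jet m I \<tau> (\<lambda>i t. \<omega> (\<eta> i t) (\<alpha> i t *\<^sub>R birkhoff_dir \<omega> (\<eta> i t))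
      * inverse (\<omega> (\<eta> i t) (birkhoff_dir \<omega> (\<eta> i t))))"
    by (intro common_jet_mult common_jet_inverse common_jet_omega jet jet_\<eta>
        common_jet_birkhoff_dir[OF jet_\<eta> unit] omega_birkhoff_dir_nonzero unit base_point)
  show "\<forall>\<^sub>F t in near i. \<omega> (\<eta> i t) (\<alpha> i t *\<^sub>R birkhoff_dir \<omega> (\<eta> i t))
      * inverse (\<omega> (\<eta> i t) (birkhoff_dir \<omega> (\<eta> i t))) = \<alpha> i t" for i
    using eventually_near_I
  proof eventually_elim
    case (elim t)
    show ?case
      using omega_birkhoff_dir_nonzero[OF unit[OF elim]] by (simp add: omega_simps)
  qed
qed

text \<open>The products \<open>\<alpha> b(\<eta>)\<close> and \<open>\<kappa> b(\<eta>)\<close> are the derivatives of \<open>\<gamma>\<close> and \<open>\<eta>\<close>, and passing to a derivative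
costs one order of contact.\<close>

lemma common_jet_curvature_pair:
  assumes jet: "common_jet (Suc m) I \<tau> (\<lambda>i t. (\<gamma> i t, \<eta> i t))"
    and legendre: "\<And>i. legendre_curve (I i) (\<gamma> i) (\<eta> i)"
    and curvature: "\<And>i. curvature_pair \<omega> (I i) (\<gamma> i) (\<eta> i) (\<alpha> i) (\<kappa> i)"
  shows "common_jet m I \<tau> (\<lambda>i t. (\<alpha> i t, \<kappa> i t))"
proof -
  have jets: "common_jet (Suc m) I \<tau> \<gamma>" "common_jet (Suc m) I \<tau> \<eta>"
    using common_jet_bounded_linear[OF bounded_linear_fst jet]
      common_jet_bounded_linear[OF bounded_linear_snd jet] by simp_all
  have unit: "norm (\<eta> i t) = 1" if "t \<in> I i" for i t
    using legendre[of i] that by (simp add: legendre_curve_def)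
  have deriv: "(\<gamma> i has_vector_derivative \<alpha> i t *\<^sub>R birkhoff_dir \<omega> (\<eta> i t)) (at t within I i)"
    "(\<eta> i has_vector_derivative \<kappa> i t *\<^sub>R birkhoff_dir \<omega> (\<eta> i t)) (at t within I i)"
    if t: "t \<in> I i" for i t
  proof -
    have "smooth_map_on (I i) (\<lambda>t. (\<gamma> i t, \<eta> i t))"
      using legendre[of i] by (simp add: legendre_curve_def)
    then obtain d where d: "((\<lambda>t. (\<gamma> i t, \<eta> i t)) has_vector_derivative d) (at t within I i)"
      using smooth_map_on_has_vector_derivative t by blast
    have d1: "(\<gamma> i has_vector_derivative fst d) (at t within I i)"
      using bounded_linear.has_vector_derivative[OF bounded_linear_fst d] by simp
    have d2: "(\<eta> i has_vector_derivative snd d) (at t within I i)"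
      using bounded_linear.has_vector_derivative[OF bounded_linear_snd d] by simp
    have "fst d = \<alpha> i t *\<^sub>R birkhoff_dir \<omega> (\<eta> i t)" "snd d = \<kappa> i t *\<^sub>R birkhoff_dir \<omega> (\<eta> i t)"
      using vector_derivative_within[OF at_within_not_bot[OF t] d1]
        vector_derivative_within[OF at_within_not_bot[OF t] d2] curvature[of i] t
      by (simp_all add: curvature_pair_def)
    then show "(\<gamma> i has_vector_derivative \<alpha> i t *\<^sub>R birkhoff_dir \<omega> (\<eta> i t)) (at t within I i)"
      "(\<eta> i has_vector_derivative \<kappa> i t *\<^sub>R birkhoff_dir \<omega> (\<eta> i t)) (at t within I i)"
      using d1 d2 by simp_all
  qed
  have near: "\<forall>\<^sub>F t in near i. (\<gamma> i has_vector_derivative \<alpha> i t *\<^sub>R birkhoff_dir \<omega> (\<eta> i t)) (at t within I i)"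
    "\<forall>\<^sub>F t in near i. (\<eta> i has_vector_derivative \<kappa> i t *\<^sub>R birkhoff_dir \<omega> (\<eta> i t)) (at t within I i)" for i
    using eventually_near_I[of i] by (auto elim!: eventually_mono intro: deriv)
  note jet_\<eta> = common_jet_Suc_imp[OF jets(2)]
  show ?thesis
    by (intro common_jet_Pair common_jet_coefficient[OF jet_\<eta> unit]
        common_jet_derivative[OF jets(1) near(1)] common_jet_derivative[OF jets(2) near(2)])
qed

end

section \<open>Isometries of a strictly convex plane\<close>

text \<open>Equality in the triangle inequality forces the whole segment between the normalised vectors to
lie on the unit circle.\<close>

lemma strictly_convex_norm_parallel:
  fixes u v :: "'a::real_normed_vector"
  assumes "strictly_convex_norm TYPE('a)" and sum: "norm (u + v) = norm u + norm v"
  shows "norm v *\<^sub>R u = norm u *\<^sub>R v"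
proof (cases "u = 0 \<or> v = 0")
  case False
  define a b x y where "a = norm u" "b = norm v" "x = u /\<^sub>R a" "y = v /\<^sub>R b"
  have ab: "a > 0" "b > 0"
    using False by (simp_all add: a_b_x_y_def)
  have uv: "u = a *\<^sub>R x" "v = b *\<^sub>R y"
    using ab unfolding a_b_x_y_def(3,4) by simp_all
  have xy: "norm x = 1" "norm y = 1"
    using ab unfolding a_b_x_y_def by simp_all
  have "closed_segment x y \<subseteq> sphere 0 1"
  proof
    fix z assume "z \<in> closed_segment x y"
    then obtain t where t: "0 \<le> t" "t \<le> 1" and z: "z = (1 - t) *\<^sub>R x + t *\<^sub>R y"
      unfolding closed_segment_def by blast
    \<comment> \<open>If \<open>z\<close> had norm below 1, then splitting off the multiple \<open>c *\<^sub>R z\<close> from \<open>u + v\<close> would make the triangle inequality strict. The minimum keeps the remaining coefficients of \<open>x\<close> and \<open>y\<close> nonnegative.\<close>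
    define c where "c = min a b"
    have "c * (1 - t) \<le> c * 1" "c * t \<le> c * 1"
      using ab t unfolding c_def by (intro mult_left_mono; simp)+
    then have c: "c > 0" "c * (1 - t) \<le> a" "c * t \<le> b"
      using ab unfolding c_def by auto
    have "u + v = c *\<^sub>R z + ((a - c * (1 - t)) *\<^sub>R x + (b - c * t) *\<^sub>R y)"
      unfolding uv z by (simp add: algebra_simps)
    then have "a + b \<le> norm (c *\<^sub>R z) + norm ((a - c * (1 - t)) *\<^sub>R x + (b - c * t) *\<^sub>R y)"
      using sum norm_triangle_ineq unfolding a_b_x_y_def(1,2) by metis
    also have "\<dots> \<le> norm (c *\<^sub>R z) + (norm ((a - c * (1 - t)) *\<^sub>R x) + norm ((b - c * t) *\<^sub>R y))"
      by (intro add_left_mono norm_triangle_ineq)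
    also have "\<dots> = c * norm z + ((a - c * (1 - t)) + (b - c * t))"
      using c xy by simp
    finally have "c * 1 \<le> c * norm z"
      by (simp add: algebra_simps)
    then have "1 \<le> norm z"
      using c(1) by (simp only: mult_le_cancel_left_pos)
    moreover have "norm z \<le> (1 - t) * norm x + t * norm y"
      unfolding z using t norm_triangle_ineq[of "(1 - t) *\<^sub>R x" "t *\<^sub>R y"] by simp
    ultimately show "z \<in> sphere 0 1"
      using xy by simp
  qed
  then have "x = y"
    using assms(1) unfolding strictly_convex_norm_def by blast
  then show ?thesis
    using ab unfolding uv by (simp add: xy mult.commute)
qed auto

text \<open>The image of a point between \<open>x\<close> and \<open>y\<close> has the right distances to the images of \<open>x\<close> and \<open>y\<close>, and
by strict convexity only one point has.\<close>

lemma plane_isometry_convex_combination: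
  fixes T :: "'a::real_normed_vector \<Rightarrow> 'a"
  assumes sc: "strictly_convex_norm TYPE('a)" and T: "plane_isometry T" and t: "0 \<le> t" "t \<le> 1"
  shows "T ((1 - t) *\<^sub>R x + t *\<^sub>R y) = (1 - t) *\<^sub>R T x + t *\<^sub>R T y"
proof (cases "x = y")
  case True
  then show ?thesis
    by (simp flip: scaleR_left_distrib)
next
  case False
  define z where "z = (1 - t) *\<^sub>R x + t *\<^sub>R y"
  let ?u = "T z - T x" and ?v = "T y - T z"
  have zx: "z - x = t *\<^sub>R (y - x)" and yz: "y - z = (1 - t) *\<^sub>R (y - x)"
    unfolding z_def by (simp_all add: algebra_simps)
  have u: "norm ?u = t * norm (y - x)" and v: "norm ?v = (1 - t) * norm (y - x)"
    using T t unfolding plane_isometry_def by (simp_all add: zx yz)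
  have "norm (?u + ?v) = norm (y - x)"
    using T unfolding plane_isometry_def by simp
  also have "\<dots> = norm ?u + norm ?v"
    unfolding u v by (simp add: algebra_simps)
  finally have "norm ?v *\<^sub>R ?u = norm ?u *\<^sub>R ?v"
    by (rule strictly_convex_norm_parallel[OF sc])
  then have "norm (y - x) *\<^sub>R ((1 - t) *\<^sub>R ?u) = norm (y - x) *\<^sub>R (t *\<^sub>R ?v)"
    unfolding u v by (simp add: mult.commute)
  then have "(1 - t) *\<^sub>R ?u = t *\<^sub>R ?v"
    unfolding scaleR_cancel_left using False by simp
  then have "T z = (1 - t) *\<^sub>R T x + t *\<^sub>R T y"
    by (simp add: algebra_simps)
  then show ?thesis
    unfolding z_def .
qed

lemma norm_linear_part:
  "plane_isometry T \<Longrightarrow> norm (linear_part T x) = norm x"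
  unfolding plane_isometry_def linear_part_def by (metis diff_zero)

lemma linear_linear_part:
  fixes T :: "'a::real_normed_vector \<Rightarrow> 'a"
  assumes sc: "strictly_convex_norm TYPE('a)" and T: "plane_isometry T"
  shows "linear (linear_part T)"
proof -
  let ?L = "linear_part T"
  note comb = plane_isometry_convex_combination[OF sc T]
  have scale: "?L (t *\<^sub>R x) = t *\<^sub>R ?L x" if "0 \<le> t" "t \<le> 1" for t x
    using comb[OF that, of 0 x] by (simp add: linear_part_def algebra_simps)
  have add: "?L (x + y) = ?L x + ?L y" for x y
  proof -
    have "?L ((1/2) *\<^sub>R (x + y)) = (1/2) *\<^sub>R (?L x + ?L y)"
      using comb[of "1/2" x y] by (simp add: linear_part_def algebra_simps flip: scaleR_left_distrib)
    moreover have "?L ((1/2) *\<^sub>R (x + y)) = (1/2) *\<^sub>R ?L (x + y)"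
      by (rule scale) simp_all
    ultimately show ?thesis
      by simp
  qed
  have nonneg: "?L (t *\<^sub>R x) = t *\<^sub>R ?L x" if "0 \<le> t" for t x
  proof (cases "t \<le> 1")
    case False
    then have "?L x = ?L ((1 / t) *\<^sub>R (t *\<^sub>R x))"
      by simp
    also have "\<dots> = (1 / t) *\<^sub>R ?L (t *\<^sub>R x)"
      using False by (intro scale) auto
    finally have "t *\<^sub>R ?L x = t *\<^sub>R ((1 / t) *\<^sub>R ?L (t *\<^sub>R x))"
      by (rule arg_cong)
    then show ?thesis
      using False by simp
  qed (use scale that in blast)
  show ?thesis
  proof (rule linearI[OF add])
    fix t :: real and x
    show "?L (t *\<^sub>R x) = t *\<^sub>R ?L x"
    proof (cases "0 \<le> t")
      case False
      have "?L (t *\<^sub>R x) + ?L ((- t) *\<^sub>R x) = ?L (t *\<^sub>R x + (- t) *\<^sub>R x)"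
        by (rule add[symmetric])
      also have "\<dots> = 0"
        by (simp add: linear_part_def)
      finally have "?L (t *\<^sub>R x) = - ?L ((- t) *\<^sub>R x)"
        by (simp only: eq_neg_iff_add_eq_0)
      also have "?L ((- t) *\<^sub>R x) = (- t) *\<^sub>R ?L x"
        by (rule nonneg) (use False in simp)
      finally show ?thesis
        by simp
    qed (rule nonneg)
  qed
qed

section \<open>Transitive isometry groups and the maximal quadratic form\<close>

text \<open>Strict concavity, on positive definite binary forms of a given discriminant: up to a positive
factor, the excess of the discriminant of the midpoint over \<open>D\<close> is
\<open>D * (a - a')\<^sup>2 + (a * b' - a' * b)\<^sup>2\<close>.\<close>

lemma det_midpoint_unique:
  fixes a b c a' b' c' :: real
  assumes "a > 0" "a' > 0" and D: "a * c - b\<^sup>2 = D" "a' * c' - b'\<^sup>2 = D" "D > 0"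
    and mid: "(a + a') / 2 * ((c + c') / 2) - ((b + b') / 2)\<^sup>2 \<le> D"
  shows "a = a' \<and> b = b' \<and> c = c'"
proof -
  have "a * c' + a' * c - 2 * b * b' \<le> 2 * D"
    using mid D by (simp add: power2_eq_square field_simps)
  then have "a * a' * (a * c' + a' * c - 2 * b * b' - 2 * D) \<le> 0"
    using assms(1,2) by (simp add: mult_le_0_iff)
  moreover have "a * a' * (a * c' + a' * c - 2 * b * b' - 2 * D)
      = a\<^sup>2 * (a' * c') + a'\<^sup>2 * (a * c) - 2 * (a * a' * b * b') - 2 * a * a' * D"
    by (simp add: power2_eq_square algebra_simps)
  moreover have "a' * c' = D + b'\<^sup>2" "a * c = D + b\<^sup>2"
    using D by simp_all
  ultimately have "D * (a - a')\<^sup>2 + (a * b' - a' * b)\<^sup>2 \<le> 0"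
    by (simp add: power2_eq_square algebra_simps)
  moreover have "D * (a - a')\<^sup>2 \<ge> 0" "(a * b' - a' * b)\<^sup>2 \<ge> 0"
    using \<open>D > 0\<close> by simp_all
  ultimately have "D * (a - a')\<^sup>2 = 0" "(a * b' - a' * b)\<^sup>2 = 0"
    by linarith+
  then have "a = a'" "a * b' = a' * b"
    using \<open>D > 0\<close> by simp_all
  then have "b = b'"
    using \<open>a > 0\<close> by simp
  moreover have "a * c = a * c'"
    using D unfolding \<open>a = a'\<close> \<open>b = b'\<close> by linarith
  ultimately show ?thesis
    using \<open>a = a'\<close> \<open>a > 0\<close> by simp
qed

text \<open>The triple \<open>(a, b, c)\<close> stands for the quadratic form \<open>a x\<^sup>2 + 2 b x y + c y\<^sup>2\<close> in the coordinates of a basis.\<close>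

type_synonym quadratic_coeffs = "real \<times> real \<times> real"

definition discriminant :: "quadratic_coeffs \<Rightarrow> real" where
  "discriminant P = fst P * snd (snd P) - (fst (snd P))\<^sup>2"

locale symplectic_basis = symplectic_plane \<omega>
  for \<omega> :: "'a::real_normed_vector \<Rightarrow> 'a \<Rightarrow> real" +
  fixes p q :: 'a
  assumes omega_basis: "\<omega> p q = 1"
begin

definition form :: "quadratic_coeffs \<Rightarrow> 'a \<Rightarrow> 'a \<Rightarrow> real" where
  "form P x y = fst P * (\<omega> x q * \<omega> y q) + fst (snd P) * (\<omega> x q * \<omega> p y + \<omega> p x * \<omega> y q)
     + snd (snd P) * (\<omega> p x * \<omega> p y)"

text \<open>Geometrically, the ellipses (possibly degenerate) that contain the unit ball of the norm. A form
of maximal discriminant corresponds to an ellipse of minimal area, the Loewner ellipse.\<close>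

definition below_norm :: "quadratic_coeffs set" where
  "below_norm = {P. \<forall>x. 0 \<le> form P x x \<and> form P x x \<le> (norm x)\<^sup>2}"

lemma basis_coords: "\<omega> p p = 0" "\<omega> q q = 0" "\<omega> p q = 1"
  by (simp_all add: omega_basis)

lemma bilinear_form: "bilinear (form P)"
  unfolding bilinear_def by (auto intro!: linearI simp: form_def omega_simps algebra_simps)

lemma compact_below_norm: "compact below_norm"
proof -
  have "closed below_norm"
    unfolding below_norm_def form_def
    by (intro closed_Collect_all closed_Collect_conj closed_Collect_le continuous_intros)
  moreover have "bounded below_norm"
  proof (rule boundedI)
    fix P assume P: "P \<in> below_norm"
    obtain a b c where abc: "P = (a, b, c)"
      by (cases P)
    have "form P p p = a" "form P q q = c" "form P (p + q) (p + q) = a + 2 * b + c"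
      by (simp_all add: form_def abc omega_simps basis_coords)
    moreover have "0 \<le> form P x x" "form P x x \<le> (norm x)\<^sup>2" for x
      using P by (simp_all add: below_norm_def)
    ultimately have "0 \<le> a" "a \<le> (norm p)\<^sup>2" "0 \<le> c" "c \<le> (norm q)\<^sup>2"
      "0 \<le> a + 2 * b + c" "a + 2 * b + c \<le> (norm (p + q))\<^sup>2"
      by metis+
    moreover have "norm P \<le> \<bar>a\<bar> + (\<bar>b\<bar> + \<bar>c\<bar>)"
      unfolding abc using norm_Pair_le[of a "(b, c)"] norm_Pair_le[of b c] by simp
    ultimately show "norm P \<le> 2 * (norm p)\<^sup>2 + 2 * (norm q)\<^sup>2 + (norm (p + q))\<^sup>2"
      by linarith
  qed
  ultimately show ?thesis
    by (simp add: compact_eq_bounded_closed)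
qed

lemma maximal_form:
  obtains P where "P \<in> below_norm" "discriminant P > 0"
    "\<And>R. R \<in> below_norm \<Longrightarrow> discriminant R \<le> discriminant P"
proof -
  obtain m where m: "m > 0" "\<And>x y. m * norm (x, y) \<le> norm (x *\<^sub>R p + y *\<^sub>R q)"
    by (rule norm_ge_coordinates[OF omega_basis]) blast
  have "form (m\<^sup>2, 0, m\<^sup>2) x x \<le> (norm x)\<^sup>2" for x
  proof -
    have "form (m\<^sup>2, 0, m\<^sup>2) x x = (m * norm (\<omega> x q, \<omega> p x))\<^sup>2"
      by (simp add: form_def norm_Pair power_mult_distrib power2_eq_square[of "\<omega> x q"]
          power2_eq_square[of "\<omega> p x"] algebra_simps)
    also have "\<dots> \<le> (norm x)\<^sup>2"
      using m(2)[of "\<omega> x q" "\<omega> p x"] coordinates[OF omega_basis, of x] m(1)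
      by (intro power_mono) simp_all
    finally show ?thesis .
  qed
  then have R: "(m\<^sup>2, 0, m\<^sup>2) \<in> below_norm"
    by (simp add: below_norm_def) (simp add: form_def)
  have "continuous_on below_norm discriminant"
    unfolding discriminant_def by (intro continuous_intros)
  then obtain P where P: "P \<in> below_norm" "\<And>R. R \<in> below_norm \<Longrightarrow> discriminant R \<le> discriminant P"
    using continuous_attains_sup[OF compact_below_norm, of discriminant] R by blast
  have "0 < discriminant (m\<^sup>2, 0, m\<^sup>2)"
    using m(1) by (simp add: discriminant_def)
  also have "\<dots> \<le> discriminant P"
    by (rule P(2)[OF R])
  finally show thesis
    using that P by blast
qed

lemma maximal_form_unique:
  assumes P: "P \<in> below_norm" "discriminant P > 0"
    and max: "\<And>R. R \<in> below_norm \<Longrightarrow> discriminant R \<le> discriminant P"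
    and P': "P' \<in> below_norm" "discriminant P \<le> discriminant P'"
  shows "P' = P"
proof -
  obtain a b c a' b' c' where abc: "P = (a, b, c)" "P' = (a', b', c')"
    by (metis prod_cases3)
  have eq: "discriminant P' = discriminant P"
    using max[OF P'(1)] P'(2) by simp
  have "form P p p \<ge> 0" "form P' p p \<ge> 0"
    using P(1) P'(1) by (simp_all add: below_norm_def)
  then have "a \<ge> 0" "a' \<ge> 0"
    by (simp_all add: form_def abc basis_coords)
  moreover have "a * c - b\<^sup>2 > 0" "a' * c' - b'\<^sup>2 > 0"
    using P(2) eq by (simp_all add: discriminant_def abc)
  then have "a \<noteq> 0" "a' \<noteq> 0"
    by (auto simp: not_less)
  ultimately have pos: "a > 0" "a' > 0"
    by simp_all
  let ?M = "((a + a') / 2, (b + b') / 2, (c + c') / 2)"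
  have form_M: "form ?M x x = (form P x x + form P' x x) / 2" for x
    by (simp add: form_def abc field_simps)
  have bounds: "0 \<le> form P x x" "form P x x \<le> (norm x)\<^sup>2" "0 \<le> form P' x x" "form P' x x \<le> (norm x)\<^sup>2" for x
    using P(1) P'(1) by (simp_all add: below_norm_def)
  have "0 \<le> form ?M x x" "form ?M x x \<le> (norm x)\<^sup>2" for x
    unfolding form_M using bounds[of x] by simp_all
  then have "?M \<in> below_norm"
    by (simp only: below_norm_def mem_Collect_eq) blast
  then have "discriminant ?M \<le> discriminant P"
    by (rule max)
  then have "a = a' \<and> b = b' \<and> c = c'"
    using eq P(2) pos by (intro det_midpoint_unique[where D = "discriminant P"]) (simp_all add: discriminant_def abc)
  then show ?thesis
    by (simp add: abc)
qed

definition pullback :: "('a \<Rightarrow> 'a) \<Rightarrow> quadratic_coeffs \<Rightarrow> quadratic_coeffs" where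
  "pullback L P = (form P (L p) (L p), form P (L p) (L q), form P (L q) (L q))"

lemma linear_coordinates:
  assumes "linear L"
  shows "L x = \<omega> x q *\<^sub>R L p + \<omega> p x *\<^sub>R L q"
proof -
  have "L x = L (\<omega> x q *\<^sub>R p + \<omega> p x *\<^sub>R q)"
    by (rule arg_cong[OF coordinates[OF omega_basis]])
  then show ?thesis
    by (simp only: linear_add[OF assms] linear_scale[OF assms])
qed

lemma form_commute: "form P x y = form P y x"
  by (simp add: form_def algebra_simps)

lemma form_pullback:
  assumes "linear L"
  shows "form (pullback L P) x y = form P (L x) (L y)"
proof -
  note B = bilinear_form[of P]
  have "form P (L x) (L y) = form P (\<omega> x q *\<^sub>R L p + \<omega> p x *\<^sub>R L q) (\<omega> y q *\<^sub>R L p + \<omega> p y *\<^sub>R L q)"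
    using linear_coordinates[OF assms, of x] linear_coordinates[OF assms, of y] by simp
  also have "\<dots> = form (pullback L P) x y"
    unfolding pullback_def form_def[of "(a, b, c)" for a b c]
    by (simp add: bilinear_ladd[OF B] bilinear_radd[OF B] bilinear_lmul[OF B] bilinear_rmul[OF B]
        form_commute[of P "L q" "L p"] algebra_simps)
  finally show ?thesis ..
qed

lemma discriminant_pullback:
  "discriminant (pullback L P) = discriminant P * (\<omega> (L p) (L q))\<^sup>2"
proof -
  have "\<omega> (L p) (L q) = \<omega> (L p) q * \<omega> p (L q) - \<omega> (L q) q * \<omega> p (L p)"
    using omega_omega[of p q "L p" "L q"] by (simp add: omega_basis)
  then show ?thesis
    unfolding discriminant_def pullback_def form_def fst_conv snd_conv
    by (simp only:) (simp add: power2_eq_square algebra_simps)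
qed

lemma omega_linear:
  assumes "linear L"
  shows "\<omega> (L x) (L y) = \<omega> (L p) (L q) * \<omega> x y"
proof -
  have "\<omega> (L x) (L y) = \<omega> (\<omega> x q *\<^sub>R L p + \<omega> p x *\<^sub>R L q) (\<omega> y q *\<^sub>R L p + \<omega> p y *\<^sub>R L q)"
    using linear_coordinates[OF assms, of x] linear_coordinates[OF assms, of y] by simp
  also have "\<dots> = \<omega> (L p) (L q) * (\<omega> x q * \<omega> p y - \<omega> y q * \<omega> p x)"
    using omega_swap[of "L p" "L q"] by (simp add: omega_simps algebra_simps)
  also have "\<omega> x q * \<omega> p y - \<omega> y q * \<omega> p x = \<omega> x y"
    using omega_omega[of p q x y] by (simp add: omega_basis)
  finally show ?thesis .
qed

text \<open>The inverse is given by Cramer's rule in the basis \<open>L p\<close>, \<open>L q\<close>.\<close>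

lemma linear_isometry_inverse:
  fixes L :: "'a \<Rightarrow> 'a"
  assumes L: "linear L" and iso: "\<And>x. norm (L x) = norm x"
  obtains M where "linear M" "\<And>x. norm (M x) = norm x" "\<And>x. L (M x) = x"
proof -
  have "\<omega> (L p) (L q) \<noteq> 0"
  proof
    assume 0: "\<omega> (L p) (L q) = 0"
    have "p \<noteq> 0"
      using omega_basis by (auto simp: omega_simps)
    then have "L p \<noteq> 0"
      using iso[of p] by auto
    then obtain t where "L q = t *\<^sub>R L p"
      using 0 parallel by blast
    then have "L (q - t *\<^sub>R p) = 0"
      by (simp add: linear_diff[OF L] linear_scale[OF L])
    then have "q = t *\<^sub>R p"
      using iso[of "q - t *\<^sub>R p"] by simp
    then show False
      using omega_basis by (simp add: omega_simps)
  qed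
  then have nz: "\<omega> (L p) (L q) \<noteq> 0" .
  define M where "M x = (\<omega> x (L q) / \<omega> (L p) (L q)) *\<^sub>R p + (\<omega> (L p) x / \<omega> (L p) (L q)) *\<^sub>R q" for x
  have M: "linear M"
    by (rule linearI) (simp_all add: M_def omega_simps add_divide_distrib algebra_simps)
  have LM: "L (M x) = x" for x
  proof -
    have "\<omega> (L p) (L q) *\<^sub>R L (M x) = \<omega> x (L q) *\<^sub>R L p + \<omega> (L p) x *\<^sub>R L q"
      using nz by (simp add: M_def linear_add[OF L] linear_scale[OF L] scaleR_right_distrib)
    also have "\<dots> = \<omega> (L p) (L q) *\<^sub>R x"
      by (rule three_vectors[symmetric])
    finally show ?thesis
      unfolding scaleR_cancel_left using nz by blast
  qed
  then have "norm (M x) = norm x" for x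
    using iso by metis
  with M LM show thesis
    using that by blast
qed

text \<open>Pulling back along a linear isometry preserves the set of forms below the squared norm and
multiplies discriminants by the squared determinant. Maximality bounds the squared determinant
by 1, for the isometry as well as for its inverse, so the pullback is again maximal, and the
maximal form is unique.\<close>

lemma maximal_form_invariant:
  fixes L :: "'a \<Rightarrow> 'a"
  assumes P: "P \<in> below_norm" "discriminant P > 0"
    and max: "\<And>R. R \<in> below_norm \<Longrightarrow> discriminant R \<le> discriminant P"
    and L: "linear L" and iso: "\<And>x. norm (L x) = norm x"
  shows "form P (L x) (L x) = form P x x"
proof -
  have below: "pullback M P \<in> below_norm" if "linear M" "\<And>x. norm (M x) = norm x" for M :: "'a \<Rightarrow> 'a"
    using P(1) that(2) by (simp add: below_norm_def form_pullback[OF that(1)]) metis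
  have le_1: "(\<omega> (M p) (M q))\<^sup>2 \<le> 1" if "linear M" "\<And>x. norm (M x) = norm x" for M :: "'a \<Rightarrow> 'a"
    using max[OF below[OF that]] P(2) by (simp add: discriminant_pullback)
  obtain M where M: "linear M" "\<And>x. norm (M x) = norm x" "\<And>x. L (M x) = x"
    by (rule linear_isometry_inverse[OF L iso]) blast
  have "\<omega> (L p) (L q) * \<omega> (M p) (M q) = 1"
    using omega_linear[OF L, of "M p" "M q"] by (simp add: M(3) omega_basis)
  then have "(\<omega> (L p) (L q))\<^sup>2 * (\<omega> (M p) (M q))\<^sup>2 = 1"
    by (simp flip: power_mult_distrib)
  then have "1 \<le> (\<omega> (L p) (L q))\<^sup>2"
    using mult_left_mono[OF le_1[OF M(1,2)], of "(\<omega> (L p) (L q))\<^sup>2"] by simp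
  then have "discriminant P \<le> discriminant (pullback L P)"
    using P(2) by (simp add: discriminant_pullback)
  then have "pullback L P = P"
    using maximal_form_unique[OF P max below[OF L iso]] by blast
  then show ?thesis
    using form_pullback[OF L, of P x x] by simp
qed

text \<open>The maximal form is constant on the unit circle, because any two unit vectors are related by an
isometry that leaves the form invariant. So the form is a multiple of the squared norm.\<close>

lemma euclidean_if_transitive:
  assumes trans: "\<And>(x :: 'a) (y :: 'a). norm x = 1 \<Longrightarrow> norm y = 1 \<Longrightarrow>
      \<exists>L. linear L \<and> (\<forall>z. norm (L z) = norm z) \<and> L x = y"
  shows "euclidean_norm TYPE('a)"
proof -
  obtain P where P: "P \<in> below_norm" "discriminant P > 0"
    "\<And>R. R \<in> below_norm \<Longrightarrow> discriminant R \<le> discriminant P"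
    by (rule maximal_form) blast
  note B = bilinear_form[of P]
  have "p \<noteq> 0"
    using omega_basis by (auto simp: omega_simps)
  define \<mu> where "\<mu> = form P (p /\<^sub>R norm p) (p /\<^sub>R norm p)"
  have unit: "form P y y = \<mu>" if "norm y = 1" for y
  proof -
    have norm_p: "norm (p /\<^sub>R norm p) = 1"
      using \<open>p \<noteq> 0\<close> by simp
    obtain L where L: "linear L" "\<And>z. norm (L z) = norm z" "L (p /\<^sub>R norm p) = y"
      using trans[OF norm_p \<open>norm y = 1\<close>] by blast
    show ?thesis
      using maximal_form_invariant[OF P L(1,2), of "p /\<^sub>R norm p"] unfolding L(3) \<mu>_def .
  qed
  have form_eq: "form P x x = \<mu> * (norm x)\<^sup>2" for x
  proof (cases "x = 0")
    case False
    define u where "u = x /\<^sub>R norm x"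
    have x: "x = norm x *\<^sub>R u"
      using False by (simp add: u_def)
    have "form P x x = form P (norm x *\<^sub>R u) (norm x *\<^sub>R u)"
      using x by simp
    also have "\<dots> = (norm x)\<^sup>2 * form P u u"
      by (simp add: bilinear_lmul[OF B] bilinear_rmul[OF B] power2_eq_square)
    also have "form P u u = \<mu>"
      by (rule unit) (use False in \<open>simp add: u_def\<close>)
    finally show ?thesis
      by simp
  qed (simp add: bilinear_lzero[OF B])
  have "\<mu> > 0"
  proof -
    have "form P p p \<ge> 0"
      using P(1) by (simp add: below_norm_def)
    moreover have "form P p p \<noteq> 0"
      using P(2) by (auto simp: form_def basis_coords discriminant_def not_less)
    ultimately have "\<mu> * (norm p)\<^sup>2 > 0"
      unfolding form_eq[symmetric] by linarith
    then show ?thesis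
      using \<open>p \<noteq> 0\<close> by (simp add: zero_less_mult_iff)
  qed
  show ?thesis
    unfolding euclidean_norm_def
  proof (intro exI[of _ "\<lambda>x y. form P x y / \<mu>"] conjI allI impI)
    show "bilinear (\<lambda>x y. form P x y / \<mu>)"
      unfolding bilinear_def
      by (auto intro!: linearI simp: bilinear_ladd[OF B] bilinear_radd[OF B] bilinear_lmul[OF B]
          bilinear_rmul[OF B] add_divide_distrib)
    show "form P x y / \<mu> = form P y x / \<mu>" for x y
      by (simp add: form_commute)
    show "form P x x / \<mu> > 0" if "x \<noteq> 0" for x
      using that \<open>\<mu> > 0\<close> by (simp add: form_eq)
    show "norm x = sqrt (form P x x / \<mu>)" for x
      using \<open>\<mu> > 0\<close> by (simp add: form_eq)
  qed
qed

end

section \<open>Contact and the curvature pair\<close>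

lemma nth_derivative_const:
  "nth_derivative UNIV n (\<lambda>_. c) = (\<lambda>_. if n = 0 then c else 0)"
  by (induction n) simp_all

lemma smooth_map_on_const: "smooth_map_on UNIV (\<lambda>_. c)"
  by (simp add: smooth_map_on_def nth_derivative_const)

lemma legendre_curve_const: "norm c = 1 \<Longrightarrow> legendre_curve UNIV (\<lambda>_. 0) (\<lambda>_. c)"
  by (simp add: legendre_curve_def nondegenerate_interval_def smooth_map_on_const birkhoff_orthogonal_def)

lemma curvature_pair_const: "curvature_pair \<omega> UNIV (\<lambda>_. 0) (\<lambda>_. c) (\<lambda>_. 0) (\<lambda>_. 0)"
  by (simp add: curvature_pair_def smooth_map_on_const)

theorem theorem7p1:
  fixes \<omega> :: "'a::real_normed_vector \<Rightarrow> 'a \<Rightarrow> real" and k :: nat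
  assumes "dim (UNIV :: 'a set) = 2"
    and "smooth_unit_circle TYPE('a)"
    and "strictly_convex_norm TYPE('a)"
    and "symplectic_form \<omega>"
    and "k \<ge> 1"
  shows "(\<forall>I\<^sub>1 I\<^sub>2 \<gamma>\<^sub>1 \<eta>\<^sub>1 \<gamma>\<^sub>2 \<eta>\<^sub>2 \<alpha>\<^sub>1 \<kappa>\<^sub>1 \<alpha>\<^sub>2 \<kappa>\<^sub>2. \<forall>t\<^sub>0\<in>I\<^sub>1. \<forall>u\<^sub>0\<in>I\<^sub>2.
            legendre_curve I\<^sub>1 \<gamma>\<^sub>1 \<eta>\<^sub>1 \<and> curvature_pair \<omega> I\<^sub>1 \<gamma>\<^sub>1 \<eta>\<^sub>1 \<alpha>\<^sub>1 \<kappa>\<^sub>1 \<and>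
            legendre_curve I\<^sub>2 \<gamma>\<^sub>2 \<eta>\<^sub>2 \<and> curvature_pair \<omega> I\<^sub>2 \<gamma>\<^sub>2 \<eta>\<^sub>2 \<alpha>\<^sub>2 \<kappa>\<^sub>2 \<and>
            at_least_contact (Suc k) I\<^sub>1 \<gamma>\<^sub>1 \<eta>\<^sub>1 t\<^sub>0 I\<^sub>2 \<gamma>\<^sub>2 \<eta>\<^sub>2 u\<^sub>0
            \<longrightarrow> (\<forall>j<k. nth_derivative I\<^sub>1 j (\<lambda>t. (\<alpha>\<^sub>1 t, \<kappa>\<^sub>1 t)) t\<^sub>0
                     = nth_derivative I\<^sub>2 j (\<lambda>u. (\<alpha>\<^sub>2 u, \<kappa>\<^sub>2 u)) u\<^sub>0))
       \<and> (\<not> euclidean_norm TYPE('a) \<longrightarrow>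
            (\<exists>I\<^sub>1 I\<^sub>2 \<gamma>\<^sub>1 \<eta>\<^sub>1 \<gamma>\<^sub>2 \<eta>\<^sub>2 \<alpha>\<^sub>1 \<kappa>\<^sub>1 \<alpha>\<^sub>2 \<kappa>\<^sub>2. \<exists>t\<^sub>0\<in>I\<^sub>1. \<exists>u\<^sub>0\<in>I\<^sub>2.
               legendre_curve I\<^sub>1 \<gamma>\<^sub>1 \<eta>\<^sub>1 \<and> curvature_pair \<omega> I\<^sub>1 \<gamma>\<^sub>1 \<eta>\<^sub>1 \<alpha>\<^sub>1 \<kappa>\<^sub>1 \<and>
               legendre_curve I\<^sub>2 \<gamma>\<^sub>2 \<eta>\<^sub>2 \<and> curvature_pair \<omega> I\<^sub>2 \<gamma>\<^sub>2 \<eta>\<^sub>2 \<alpha>\<^sub>2 \<kappa>\<^sub>2 \<and>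
               (\<forall>j<k. nth_derivative I\<^sub>1 j (\<lambda>t. (\<alpha>\<^sub>1 t, \<kappa>\<^sub>1 t)) t\<^sub>0
                    = nth_derivative I\<^sub>2 j (\<lambda>u. (\<alpha>\<^sub>2 u, \<kappa>\<^sub>2 u)) u\<^sub>0) \<and>
               \<not> (\<exists>T. plane_isometry T \<and>
                     at_least_contact k I\<^sub>1 (T \<circ> \<gamma>\<^sub>1) (linear_part T \<circ> \<eta>\<^sub>1) t\<^sub>0
                                        I\<^sub>2 \<gamma>\<^sub>2 \<eta>\<^sub>2 u\<^sub>0)))"
proof (intro conjI impI)
  interpret symplectic_plane \<omega>
    using assms(1,4) by unfold_locales
  obtain \<phi> :: "real \<Rightarrow> 'a" where \<phi>: "smooth_map_on UNIV \<phi>"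
    "\<And>s. vector_derivative \<phi> (at s) \<noteq> 0" "range \<phi> = sphere 0 1"
    using assms(2) unfolding smooth_unit_circle_def by blast
  let ?\<phi>' = "nth_derivative UNIV 1 \<phi>"
  show "\<forall>I\<^sub>1 I\<^sub>2 \<gamma>\<^sub>1 \<eta>\<^sub>1 \<gamma>\<^sub>2 \<eta>\<^sub>2 \<alpha>\<^sub>1 \<kappa>\<^sub>1 \<alpha>\<^sub>2 \<kappa>\<^sub>2. \<forall>t\<^sub>0\<in>I\<^sub>1. \<forall>u\<^sub>0\<in>I\<^sub>2.
            legendre_curve I\<^sub>1 \<gamma>\<^sub>1 \<eta>\<^sub>1 \<and> curvature_pair \<omega> I\<^sub>1 \<gamma>\<^sub>1 \<eta>\<^sub>1 \<alpha>\<^sub>1 \<kappa>\<^sub>1 \<and>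
            legendre_curve I\<^sub>2 \<gamma>\<^sub>2 \<eta>\<^sub>2 \<and> curvature_pair \<omega> I\<^sub>2 \<gamma>\<^sub>2 \<eta>\<^sub>2 \<alpha>\<^sub>2 \<kappa>\<^sub>2 \<and>
            at_least_contact (Suc k) I\<^sub>1 \<gamma>\<^sub>1 \<eta>\<^sub>1 t\<^sub>0 I\<^sub>2 \<gamma>\<^sub>2 \<eta>\<^sub>2 u\<^sub>0
            \<longrightarrow> (\<forall>j<k. nth_derivative I\<^sub>1 j (\<lambda>t. (\<alpha>\<^sub>1 t, \<kappa>\<^sub>1 t)) t\<^sub>0
                     = nth_derivative I\<^sub>2 j (\<lambda>u. (\<alpha>\<^sub>2 u, \<kappa>\<^sub>2 u)) u\<^sub>0)"
  proof (intro allI ballI impI, elim conjE)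
    fix I\<^sub>1 I\<^sub>2 and \<gamma>\<^sub>1 \<eta>\<^sub>1 \<gamma>\<^sub>2 \<eta>\<^sub>2 :: "real \<Rightarrow> 'a" and \<alpha>\<^sub>1 \<kappa>\<^sub>1 \<alpha>\<^sub>2 \<kappa>\<^sub>2 t\<^sub>0 u\<^sub>0 j
    assume base: "t\<^sub>0 \<in> I\<^sub>1" "u\<^sub>0 \<in> I\<^sub>2" and "j < k"
      and legendre: "legendre_curve I\<^sub>1 \<gamma>\<^sub>1 \<eta>\<^sub>1" "legendre_curve I\<^sub>2 \<gamma>\<^sub>2 \<eta>\<^sub>2"
      and curvature: "curvature_pair \<omega> I\<^sub>1 \<gamma>\<^sub>1 \<eta>\<^sub>1 \<alpha>\<^sub>1 \<kappa>\<^sub>1" "curvature_pair \<omega> I\<^sub>2 \<gamma>\<^sub>2 \<eta>\<^sub>2 \<alpha>\<^sub>2 \<kappa>\<^sub>2"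
      and contact: "at_least_contact (Suc k) I\<^sub>1 \<gamma>\<^sub>1 \<eta>\<^sub>1 t\<^sub>0 I\<^sub>2 \<gamma>\<^sub>2 \<eta>\<^sub>2 u\<^sub>0"
    \<comment> \<open>The two curves form a family indexed by the truth values.\<close>
    let ?I = "\<lambda>i. if i then I\<^sub>1 else I\<^sub>2" and ?\<tau> = "\<lambda>i. if i then t\<^sub>0 else u\<^sub>0"
    let ?\<gamma> = "\<lambda>i. if i then \<gamma>\<^sub>1 else \<gamma>\<^sub>2" and ?\<eta> = "\<lambda>i. if i then \<eta>\<^sub>1 else \<eta>\<^sub>2"
    let ?\<alpha> = "\<lambda>i. if i then \<alpha>\<^sub>1 else \<alpha>\<^sub>2" and ?\<kappa> = "\<lambda>i. if i then \<kappa>\<^sub>1 else \<kappa>\<^sub>2"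
    interpret plane_curves \<omega> \<phi> ?\<phi>' ?I ?\<tau>
    proof
      show "smooth_map_on UNIV \<phi>" "range \<phi> = sphere 0 1"
        by (fact \<phi>)+
      show "smooth_map_on UNIV ?\<phi>'"
        by (rule smooth_map_on_derivative[OF \<phi>(1)])
      show "(\<phi> has_vector_derivative ?\<phi>' s) (at s)" for s
        by (rule smooth_map_on_has_vector_derivative[OF \<phi>(1)]) simp
      show "?\<phi>' s \<noteq> 0" for s
        using \<phi>(2) by simp
      show "?\<tau> i \<in> ?I i" for i
        using base by simp
      show "nondegenerate_interval (?I i)" for i
        using legendre by (simp add: legendre_curve_def)
    qed
    have "common_jet (Suc k) ?I ?\<tau> (\<lambda>i t. (?\<gamma> i t, ?\<eta> i t))"
    proof (rule common_jetI)
      show "smooth_map_on (?I i) (\<lambda>t. (?\<gamma> i t, ?\<eta> i t))" for i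
        using legendre by (cases i) (simp_all add: legendre_curve_def)
      show "nth_derivative (?I i) n (\<lambda>t. (?\<gamma> i t, ?\<eta> i t)) (?\<tau> i)
          = nth_derivative (?I i') n (\<lambda>t. (?\<gamma> i' t, ?\<eta> i' t)) (?\<tau> i')" if "n < Suc k" for n i i'
        using contact that unfolding at_least_contact_def by (cases i; cases i') simp_all
    qed
    then have "common_jet k ?I ?\<tau> (\<lambda>i t. (?\<alpha> i t, ?\<kappa> i t))"
    proof (rule common_jet_curvature_pair)
      show "legendre_curve (?I i) (?\<gamma> i) (?\<eta> i)" for i
        using legendre by simp
      show "curvature_pair \<omega> (?I i) (?\<gamma> i) (?\<eta> i) (?\<alpha> i) (?\<kappa> i)" for i
        using curvature by simp
    qed
    from common_jet_imp_nth_derivative_eq[OF this \<open>j < k\<close>, of True False]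
    show "nth_derivative I\<^sub>1 j (\<lambda>t. (\<alpha>\<^sub>1 t, \<kappa>\<^sub>1 t)) t\<^sub>0 = nth_derivative I\<^sub>2 j (\<lambda>u. (\<alpha>\<^sub>2 u, \<kappa>\<^sub>2 u)) u\<^sub>0"
      by simp
  qed
next
  assume not_euclidean: "\<not> euclidean_norm TYPE('a)"
  interpret symplectic_plane \<omega>
    using assms(1,4) by unfold_locales
  obtain p q :: 'a where "\<omega> p q = 1"
    by (rule unit_basis)
  then interpret symplectic_basis \<omega> p q
    by unfold_locales
  obtain x y :: 'a where xy: "norm x = 1" "norm y = 1"
    and no_isometry: "\<And>L. linear L \<Longrightarrow> (\<And>z. norm (L z) = norm z) \<Longrightarrow> L x \<noteq> y"
    using euclidean_if_transitive not_euclidean by metis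
  have no_contact: "\<not> at_least_contact k UNIV (T \<circ> (\<lambda>_. 0)) (linear_part T \<circ> (\<lambda>_. x)) 0 UNIV (\<lambda>_. 0) (\<lambda>_. y) 0"
    if "plane_isometry T" for T
  proof
    assume "at_least_contact k UNIV (T \<circ> (\<lambda>_. 0)) (linear_part T \<circ> (\<lambda>_. x)) 0 UNIV (\<lambda>_. 0) (\<lambda>_. y) 0"
    \<comment> \<open>As \<open>k \<ge> 1\<close>, contact includes equality of the values at the base points.\<close>
    then have "nth_derivative UNIV 0 (\<lambda>t. ((T \<circ> (\<lambda>_. 0)) t, (linear_part T \<circ> (\<lambda>_. x)) t)) (0 :: real)
        = nth_derivative UNIV 0 (\<lambda>_. (0, y)) (0 :: real)"
      using \<open>k \<ge> 1\<close> unfolding at_least_contact_def by auto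
    then have "linear_part T x = y"
      by simp
    then show False
      using no_isometry[OF linear_linear_part[OF assms(3) that] norm_linear_part[OF that]] by blast
  qed
  show "\<exists>I\<^sub>1 I\<^sub>2 \<gamma>\<^sub>1 \<eta>\<^sub>1 \<gamma>\<^sub>2 \<eta>\<^sub>2 \<alpha>\<^sub>1 \<kappa>\<^sub>1 \<alpha>\<^sub>2 \<kappa>\<^sub>2. \<exists>t\<^sub>0\<in>I\<^sub>1. \<exists>u\<^sub>0\<in>I\<^sub>2.
               legendre_curve I\<^sub>1 \<gamma>\<^sub>1 \<eta>\<^sub>1 \<and> curvature_pair \<omega> I\<^sub>1 \<gamma>\<^sub>1 \<eta>\<^sub>1 \<alpha>\<^sub>1 \<kappa>\<^sub>1 \<and>
               legendre_curve I\<^sub>2 \<gamma>\<^sub>2 \<eta>\<^sub>2 \<and> curvature_pair \<omega> I\<^sub>2 \<gamma>\<^sub>2 \<eta>\<^sub>2 \<alpha>\<^sub>2 \<kappa>\<^sub>2 \<and>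
               (\<forall>j<k. nth_derivative I\<^sub>1 j (\<lambda>t. (\<alpha>\<^sub>1 t, \<kappa>\<^sub>1 t)) t\<^sub>0
                    = nth_derivative I\<^sub>2 j (\<lambda>u. (\<alpha>\<^sub>2 u, \<kappa>\<^sub>2 u)) u\<^sub>0) \<and>
               \<not> (\<exists>T. plane_isometry T \<and>
                     at_least_contact k I\<^sub>1 (T \<circ> \<gamma>\<^sub>1) (linear_part T \<circ> \<eta>\<^sub>1) t\<^sub>0
                                        I\<^sub>2 \<gamma>\<^sub>2 \<eta>\<^sub>2 u\<^sub>0)"
    using legendre_curve_const[OF xy(1)] legendre_curve_const[OF xy(2)]
      curvature_pair_const[of \<omega> x] curvature_pair_const[of \<omega> y] no_contact
    by (intro exI[of _ UNIV] exI[of _ "\<lambda>_. 0"] exI[of _ "\<lambda>_. x"] exI[of _ "\<lambda>_. y"] bexI[of _ 0]) auto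
qed

end
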